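(* Let $W$ be an $\omega$-Stone space and let $R$ be the Boolean ring of compact open subsets of $W$. Then $W$ is primitive iff $K(R)$ is $\sigma_{r}$-primitive.
   Context: An $\omega$-Stone space is a metrisable locally compact totally disconnected Hausdorff space (the Stone space of a countable Boolean ring). For $A$ in a Boolean ring, $(A)=\{C\mid C\subseteq A\}$. An element $A$ is pseudo-indecomposable (PI) if for all $B\subseteq A$ in the ring, either $(B)\cong(A)$ or $(A-B)\cong(A)$; a Boolean ring/its Stone space is primitive if every element is a disjoint union of finitely many PI elements. $K(W)$ is the perfect kernel of $W$ (the end of the Cantor–Bendixson sequence), and $r=r_W\colon K(W)\to\omega_1$ is the rank function $r_W(x)=\min\{\xi\mid x\notin\overline{W^{(\xi)}-K(W)}\}$. $K(R)$ denotes the Boolean ring of compact open subsets of $K(W)$ (elements $A\cap K(W)$, $A\in R$). $\mathscr{W}=\omega_1\cup\{o\}$ with $o$ below all ordinals and $a+b=\max\{a,b\}$; $\sigma_r\colon K(R)\to\mathscr{W}$ is the measure $\sigma_r(0)=o$, $\sigma_r(A)=\sup\{r(x)\mid x\in A\}$ for $A\neq0$. For a measure $\sigma$, $A\cong_\sigma B$ means there is an isomorphism $\alpha\colon(A)\to(B)$ with $\sigma(C\alpha)=\sigma(C)$ for all $C\in(A)$; $A$ is $\sigma$-PI if for all $B\subseteq A$ either $(B)\cong_\sigma(A)$ or $(A-B)\cong_\sigma(A)$; the ring is $\sigma$-primitive if every element is a disjoint union of finitely many $\sigma$-PI elements. *)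

theory Defs
  imports
    "HOL-Algebra.QuotRing"
    "HOL-Analysis.Analysis"
    "HOL-Library.Countable_Set_Type"
    "HOL-Library.Option_ord"
begin

section \<open>The ordinals below \<open>\<omega>\<^sub>1\<close>\<close>

text \<open>
  \<open>cardSuc natLeq\<close> is a cardinal order (a well-order of minimal length in its cardinality) of
  size \<open>\<aleph>\<^sub>1\<close>, hence a well-order of type \<open>\<omega>\<^sub>1\<close>. The elements of its field, ordered by it,
  serve as the countable ordinals.
\<close>

lemma Card_order_cardSuc_natLeq: "Card_order (cardSuc natLeq)"
  by (simp add: cardSuc_Card_order natLeq_Card_order)

lemma Well_order_cardSuc_natLeq: "Well_order (cardSuc natLeq)"
  using Card_order_cardSuc_natLeq card_order_on_well_order_on by blast

lemma infinite_Field_cardSuc_natLeq: "infinite (Field (cardSuc natLeq))"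
  using cardSuc_finite[OF natLeq_Card_order] by (simp add: Field_natLeq)

typedef omega1 = "Field (cardSuc natLeq)"
  using infinite_Field_cardSuc_natLeq by (metis ex_in_conv finite.emptyI)

instantiation omega1 :: wellorder
begin

definition less_eq_omega1 :: "omega1 \<Rightarrow> omega1 \<Rightarrow> bool"
  where "x \<le> y \<longleftrightarrow> (Rep_omega1 x, Rep_omega1 y) \<in> cardSuc natLeq"

definition less_omega1 :: "omega1 \<Rightarrow> omega1 \<Rightarrow> bool"
  where "x < y \<longleftrightarrow> x \<le> y \<and> x \<noteq> (y :: omega1)"

instance
proof
  have lin: "Linear_order (cardSuc natLeq)" and wf: "wf (cardSuc natLeq - Id)"
    using Well_order_cardSuc_natLeq by (auto simp: well_order_on_def)
  have refl: "\<And>a. a \<in> Field (cardSuc natLeq) \<Longrightarrow> (a, a) \<in> cardSuc natLeq"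
    and trans: "trans (cardSuc natLeq)" and anti: "antisym (cardSuc natLeq)"
    using lin by (auto simp: linear_order_on_def partial_order_on_def preorder_on_def refl_on_def)
  fix x y z :: omega1
  show "x \<le> x"
    by (simp add: less_eq_omega1_def refl Rep_omega1)
  show xz: "x \<le> y \<Longrightarrow> y \<le> z \<Longrightarrow> x \<le> z" for x y z :: omega1
    using trans by (auto simp: less_eq_omega1_def dest: transD)
  show eq: "x \<le> y \<Longrightarrow> y \<le> x \<Longrightarrow> x = y" for x y :: omega1
    using anti by (metis less_eq_omega1_def antisymD Rep_omega1_inject)
  show "(x < y) = (x \<le> y \<and> \<not> y \<le> x)"
    using eq \<open>x \<le> x\<close> by (auto simp: less_omega1_def)
  show "x \<le> y \<or> y \<le> x"
    using lin Rep_omega1[of x] Rep_omega1[of y] \<open>x \<le> x\<close>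
    unfolding less_eq_omega1_def linear_order_on_def total_on_def
    by metis
  show "P a" if *: "\<And>x. (\<And>y. y < x \<Longrightarrow> P y) \<Longrightarrow> P x" for P and a :: omega1
  proof -
    have "wf (inv_image (cardSuc natLeq - Id) Rep_omega1)"
      using wf by (rule wf_inv_image)
    moreover have "inv_image (cardSuc natLeq - Id) Rep_omega1 = {(x, y). x < y}"
      by (auto simp: inv_image_def less_omega1_def less_eq_omega1_def Rep_omega1_inject)
    ultimately have "wf {(x, y :: omega1). x < y}"
      by simp
    then show "P a"
      by (induction a rule: wf_induct_rule) (use * in auto)
  qed
qed

end

lemma countable_lessThan_omega1:
  includes cardinal_syntax
  shows "countable {..<\<xi> :: omega1}"
proof -
  have "|underS (cardSuc natLeq) (Rep_omega1 \<xi>)| <o cardSuc natLeq"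
    by (rule card_of_underS[OF Card_order_cardSuc_natLeq Rep_omega1])
  then have "|underS (cardSuc natLeq) (Rep_omega1 \<xi>)| \<le>o natLeq"
    using cardSuc_ordLeq_ordLess[OF natLeq_Card_order card_of_Card_order] by blast
  then have "countable (underS (cardSuc natLeq) (Rep_omega1 \<xi>))"
    using countable_card_le_natLeq by blast
  moreover have "inj_on Rep_omega1 {..<\<xi>}"
    by (simp add: inj_on_def Rep_omega1_inject)
  moreover have "Rep_omega1 ` {..<\<xi>} \<subseteq> underS (cardSuc natLeq) (Rep_omega1 \<xi>)"
    by (auto simp: underS_def less_omega1_def less_eq_omega1_def Rep_omega1_inject)
  ultimately show ?thesis
    by (meson countable_image_inj_on countable_subset)
qed

lemma uncountable_UNIV_omega1:
  includes cardinal_syntax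
  shows "uncountable (UNIV :: omega1 set)"
proof
  assume "countable (UNIV :: omega1 set)"
  then have "countable (Field (cardSuc natLeq))"
    by (metis countable_image type_definition.Rep_range[OF type_definition_omega1])
  then have "|Field (cardSuc natLeq)| \<le>o natLeq"
    using countable_card_le_natLeq by blast
  moreover have "|Field (cardSuc natLeq)| =o cardSuc natLeq"
    by (rule card_of_Field_ordIso[OF Card_order_cardSuc_natLeq])
  ultimately have "cardSuc natLeq \<le>o natLeq"
    using ordIso_ordLeq_trans ordIso_symmetric by blast
  then show False
    using cardSuc_greater[OF natLeq_Card_order] not_ordLeq_ordLess by blast
qed


section \<open>\<open>\<omega>\<close>-Stone spaces and the Cantor-Bendixson sequence\<close>

definition totally_disconnected_space :: "'a topology \<Rightarrow> bool"
  where "totally_disconnected_space X \<longleftrightarrow> (\<forall>S. connectedin X S \<longrightarrow> (\<exists>a. S \<subseteq> {a}))"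

text \<open>
  Second countability says that there are only countably many compact open sets, i.e. that the
  space is the Stone space of a \<^emph>\<open>countable\<close> Boolean ring.
\<close>

definition omega_Stone_space :: "'a topology \<Rightarrow> bool"
  where "omega_Stone_space X \<longleftrightarrow>
    metrizable_space X \<and> second_countable X \<and> locally_compact_space X \<and>
    totally_disconnected_space X \<and> Hausdorff_space X"

text \<open>
  All three clauses of the usual transfinite recursion are combined into one; they are recovered
  in \<open>cb_zero\<close>, \<open>cb_succ\<close> and \<open>cb_limit\<close> below.
\<close>

function cb :: "'a topology \<Rightarrow> omega1 \<Rightarrow> 'a set"
  where "cb X \<xi> = topspace X \<inter> (\<Inter>\<eta>\<in>{..<\<xi>}. X derived_set_of (cb X \<eta>))"
  by auto
termination
  by (relation "inv_image {(x, y). x < y} snd") (auto intro: wf)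

declare cb.simps [simp del]

lemma cb_subset_topspace: "cb X \<xi> \<subseteq> topspace X"
  by (subst cb.simps) blast

lemma cb_antimono: "\<eta> \<le> \<xi> \<Longrightarrow> cb X \<xi> \<subseteq> cb X \<eta>"
  by (simp only: cb.simps[of X \<xi>] cb.simps[of X \<eta>]) fastforce

lemma cb_zero:
  assumes "\<And>\<eta>. \<xi> \<le> \<eta>"
  shows "cb X \<xi> = topspace X"
proof -
  have "{..<\<xi>} = {}"
    using leD[OF assms] by blast
  then show ?thesis
    by (simp add: cb.simps[of X \<xi>])
qed

lemma cb_succ:
  assumes "\<eta> < \<xi>" and *: "\<And>\<zeta>. \<zeta> < \<xi> \<Longrightarrow> \<zeta> \<le> \<eta>"
  shows "cb X \<xi> = X derived_set_of (cb X \<eta>)"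
proof
  show "cb X \<xi> \<subseteq> X derived_set_of (cb X \<eta>)"
    using assms(1) by (subst cb.simps[of X \<xi>]) blast
  show "X derived_set_of (cb X \<eta>) \<subseteq> cb X \<xi>"
  proof -
    have "X derived_set_of (cb X \<eta>) \<subseteq> X derived_set_of (cb X \<zeta>)" if "\<zeta> < \<xi>" for \<zeta>
      by (rule derived_set_of_mono[OF cb_antimono[OF *[OF that]]])
    then show ?thesis
      unfolding cb.simps[of X \<xi>]
      by (intro Int_greatest INT_greatest derived_set_of_subset_topspace) simp
  qed
qed

lemma cb_limit:
  assumes "\<eta>\<^sub>0 < \<xi>" and "\<And>\<eta>. \<eta> < \<xi> \<Longrightarrow> \<exists>\<zeta>. \<eta> < \<zeta> \<and> \<zeta> < \<xi>"
  shows "cb X \<xi> = (\<Inter>\<eta>\<in>{..<\<xi>}. cb X \<eta>)"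
proof
  show "cb X \<xi> \<subseteq> (\<Inter>\<eta>\<in>{..<\<xi>}. cb X \<eta>)"
    by (intro INT_greatest cb_antimono) simp
  show "(\<Inter>\<eta>\<in>{..<\<xi>}. cb X \<eta>) \<subseteq> cb X \<xi>"
  proof
    fix x
    assume x: "x \<in> (\<Inter>\<eta>\<in>{..<\<xi>}. cb X \<eta>)"
    have "x \<in> X derived_set_of cb X \<eta>" if \<eta>: "\<eta> < \<xi>" for \<eta>
    proof -
      obtain \<zeta> where "\<eta> < \<zeta>" "\<zeta> < \<xi>" using assms(2)[OF \<eta>] by blast
      with x have "x \<in> cb X \<zeta>" by auto
      with \<open>\<eta> < \<zeta>\<close> show ?thesis by (simp only: cb.simps[of X \<zeta>]) blast
    qed
    moreover have "x \<in> topspace X"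
      using x assms(1) cb_subset_topspace[of X "\<eta>\<^sub>0"] by auto
    ultimately show "x \<in> cb X \<xi>"
      by (simp only: cb.simps[of X \<xi>]) blast
  qed
qed

text \<open>
  The sequence is decreasing, and in a second countable space it is eventually constant; its
  eventual value is its intersection (\<open>perfect_kernel_eq\<close>).
\<close>

definition perfect_kernel :: "'a topology \<Rightarrow> 'a set"
  where "perfect_kernel X = (\<Inter>\<xi>. cb X \<xi>)"

lemma perfect_kernel_eq:
  assumes "\<And>\<eta>. \<xi> \<le> \<eta> \<Longrightarrow> cb X \<eta> = cb X \<xi>"
  shows "perfect_kernel X = cb X \<xi>"
proof -
  have "cb X \<xi> \<subseteq> cb X \<eta>" for \<eta>
    using assms[of \<eta>] cb_antimono[of \<eta> \<xi> X] by (cases "\<xi> \<le> \<eta>") auto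
  then show ?thesis
    unfolding perfect_kernel_def by blast
qed

text \<open>The rank function is only meaningful on the perfect kernel.\<close>

definition rank_fun :: "'a topology \<Rightarrow> 'a \<Rightarrow> omega1"
  where "rank_fun X x = (LEAST \<xi>. x \<notin> Abstract_Topology.closure_of X (cb X \<xi> - perfect_kernel X))"


section \<open>Boolean rings of sets\<close>

text \<open>
  A Boolean ring is given by its set \<open>R\<close> of elements, which are sets added by symmetric
  difference and multiplied by intersection. The ring \<open>(A)\<close> has unit \<open>A\<close>, although \<open>R\<close> itself
  need not have a unit.
\<close>

definition compact_opens :: "'a topology \<Rightarrow> 'a set set"
  where "compact_opens X = {A. compactin X A \<and> openin X A}"

definition below_ring :: "'a set set \<Rightarrow> 'a set \<Rightarrow> 'a set ring"
  where "below_ring R A =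
    \<lparr>carrier = {C \<in> R. C \<subseteq> A}, monoid.mult = (\<inter>), one = A, zero = {}, add = sym_diff\<rparr>"

definition pseudo_indecomposable :: "'a set set \<Rightarrow> 'a set \<Rightarrow> bool"
  where "pseudo_indecomposable R A \<longleftrightarrow>
    (\<forall>B\<in>R. B \<subseteq> A \<longrightarrow>
      below_ring R B \<simeq> below_ring R A \<or> below_ring R (A - B) \<simeq> below_ring R A)"

definition primitive_ring :: "'a set set \<Rightarrow> bool"
  where "primitive_ring R \<longleftrightarrow>
    (\<forall>A\<in>R. \<exists>F. finite F \<and> F \<subseteq> R \<and> disjoint F \<and> \<Union>F = A \<and>
      (\<forall>P\<in>F. pseudo_indecomposable R P))"

definition primitive_space :: "'a topology \<Rightarrow> bool"
  where "primitive_space X \<longleftrightarrow> primitive_ring (compact_opens X)"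


section \<open>Measures\<close>

text \<open>
  The monoid \<open>\<omega>\<^sub>1 \<union> {o}\<close>: \<open>None\<close> is \<open>o\<close>, which \<open>Option_ord\<close> puts below all \<open>Some \<xi>\<close>.
\<close>

type_synonym measure_value = "omega1 option"

definition measure_iso ::
    "'a set set \<Rightarrow> ('a set \<Rightarrow> measure_value) \<Rightarrow> 'a set \<Rightarrow> 'a set \<Rightarrow> bool"
  where "measure_iso R \<sigma> A B \<longleftrightarrow>
    (\<exists>\<alpha>\<in>ring_iso (below_ring R A) (below_ring R B).
      \<forall>C\<in>carrier (below_ring R A). \<sigma> (\<alpha> C) = \<sigma> C)"

definition measure_pseudo_indecomposable ::
    "'a set set \<Rightarrow> ('a set \<Rightarrow> measure_value) \<Rightarrow> 'a set \<Rightarrow> bool"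
  where "measure_pseudo_indecomposable R \<sigma> A \<longleftrightarrow>
    (\<forall>B\<in>R. B \<subseteq> A \<longrightarrow> measure_iso R \<sigma> B A \<or> measure_iso R \<sigma> (A - B) A)"

definition measure_primitive :: "'a set set \<Rightarrow> ('a set \<Rightarrow> measure_value) \<Rightarrow> bool"
  where "measure_primitive R \<sigma> \<longleftrightarrow>
    (\<forall>A\<in>R. \<exists>F. finite F \<and> F \<subseteq> R \<and> disjoint F \<and> \<Union>F = A \<and>
      (\<forall>P\<in>F. measure_pseudo_indecomposable R \<sigma> P))"

definition kernel_ring :: "'a topology \<Rightarrow> 'a set set"
  where "kernel_ring X = compact_opens (subtopology X (perfect_kernel X))"

text \<open>
  The supremum is the least upper bound in \<open>\<omega>\<^sub>1 \<union> {o}\<close>; it exists for the countable ordinals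
  attained on a compact set of an \<open>\<omega>\<close>-Stone space.
\<close>

definition rank_measure :: "'a topology \<Rightarrow> 'a set \<Rightarrow> measure_value"
  where "rank_measure X A =
    (if A = {} then None else (LEAST u. \<forall>x\<in>A. Some (rank_fun X x) \<le> u))"

end

(*
A ring isomorphism (A) -> (B) is a homeomorphism of A onto B, so it preserves the Cantor-Bendixson
sequence, the perfect kernel K and the rank function; hence it restricts to a measure preserving
isomorphism of the traces on K, and PI sets have sigma-PI traces.

For the converse, call A tight if every term of the Cantor-Bendixson sequence that has a point of
A outside K has a limit of such points in A \<inter> K. A tight set is determined up to
isomorphism by its trace on K with the rank measure: by Vaught's criterion it is enough to split
partners compatibly, and a scattered set lost on one side is matched, singleton by singleton, by
small sets cut out of the other side near a limit point in K. Every compact open set is a tight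
set plus a scattered one; a scattered set is a finite sum of sets P that meet some term of the
sequence in a single point, and those are PI.
*)

theory Submission
  imports Defs
begin

section \<open>Rings of sets and Vaught's criterion\<close>

text \<open>An isomorphism between traces on \<open>K\<close> says nothing about points off
  \<open>K\<close>: a lift of a trace to \<open>R\<close> is determined only up to scattered sets,
  and the halves of a tight set need not both be tight. So a matched pair is split not into matched
  pairs but into finite sums of them, and the relation given to Vaught's criterion is
  \<open>sum_rel matched\<close>. Splitting succeeds because \<open>limits_off C \<xi>\<close>
  decreases in \<open>\<xi>\<close>: the ordinals at which a half has limits in its core form an
  initial segment, so one half attains everything the other does. That half stays tight and can give
  or take scattered sets for both. Letting the core be any closed set containing the kernel part
  makes singular sets instances of the same relation, with a point as core. The partners that
  \<open>carve\<close> finds must be split in their turn, which looks circular; but back-and-forth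
  only asks that the relation be closed under a single splitting, so there is no recursion to
  found.\<close>

locale set_ring =
  fixes R :: "'a set set"
  assumes empty_mem: "{} \<in> R"
    and Un_mem: "A \<in> R \<Longrightarrow> B \<in> R \<Longrightarrow> A \<union> B \<in> R"
    and Diff_mem: "A \<in> R \<Longrightarrow> B \<in> R \<Longrightarrow> A - B \<in> R"
begin

lemma Int_mem: "A \<in> R \<Longrightarrow> B \<in> R \<Longrightarrow> A \<inter> B \<in> R"
  using Diff_mem[of A "A - B"] Diff_mem[of A B] by (simp add: Diff_Diff_Int)

lemma Union_mem: "finite F \<Longrightarrow> F \<subseteq> R \<Longrightarrow> \<Union>F \<in> R"
  by (induction rule: finite_induct) (auto intro: empty_mem Un_mem)

end

lemma carrier_below_ring [simp]: "carrier (below_ring R A) = {C \<in> R. C \<subseteq> A}"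
  by (simp add: below_ring_def)

text \<open>Source and target families differ because a core isomorphism runs between
  \<open>trace C\<close> and \<open>trace D\<close>.\<close>

lemma below_ring_isoI:
  assumes "\<And>C. C \<in> R \<Longrightarrow> C \<subseteq> A \<Longrightarrow> h C \<in> S \<and> h C \<subseteq> B"
    and "\<And>D. D \<in> S \<Longrightarrow> D \<subseteq> B \<Longrightarrow> \<exists>C\<in>R. C \<subseteq> A \<and> h C = D"
    and "\<And>C C'. C \<in> R \<Longrightarrow> C \<subseteq> A \<Longrightarrow> C' \<in> R \<Longrightarrow> C' \<subseteq> A \<Longrightarrow> h C = h C' \<Longrightarrow> C = C'"
    and "\<And>C C'. C \<in> R \<Longrightarrow> C \<subseteq> A \<Longrightarrow> C' \<in> R \<Longrightarrow> C' \<subseteq> A \<Longrightarrow> h (C \<inter> C') = h C \<inter> h C'"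
    and "\<And>C C'. C \<in> R \<Longrightarrow> C \<subseteq> A \<Longrightarrow> C' \<in> R \<Longrightarrow> C' \<subseteq> A \<Longrightarrow>
      h (sym_diff C C') = sym_diff (h C) (h C')"
    and "h A = B"
  shows "h \<in> ring_iso (below_ring R A) (below_ring S B)"
proof (rule ring_iso_memI)
  show "bij_betw h (carrier (below_ring R A)) (carrier (below_ring S B))"
    unfolding carrier_below_ring
  proof (rule bij_betw_imageI)
    show "inj_on h {C \<in> R. C \<subseteq> A}"
      using assms(3) by (intro inj_onI) blast
    show "h ` {C \<in> R. C \<subseteq> A} = {C \<in> S. C \<subseteq> B}"
      using assms(1,2) by (auto simp: image_iff) metis
  qed
qed (use assms(1,4,5,6) in \<open>simp_all add: below_ring_def\<close>)

lemma
  assumes h: "h \<in> ring_iso (below_ring R A) (below_ring S B)"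
    and C: "C \<in> R" "C \<subseteq> A"
  shows below_ring_iso_mem: "h C \<in> S" "h C \<subseteq> B"
    and below_ring_iso_Int: "\<And>C'. C' \<in> R \<Longrightarrow> C' \<subseteq> A \<Longrightarrow> h (C \<inter> C') = h C \<inter> h C'"
    and below_ring_iso_sym_diff:
      "\<And>C'. C' \<in> R \<Longrightarrow> C' \<subseteq> A \<Longrightarrow> h (sym_diff C C') = sym_diff (h C) (h C')"
    and below_ring_iso_top: "h A = B"
    and below_ring_iso_inj: "\<And>C'. C' \<in> R \<Longrightarrow> C' \<subseteq> A \<Longrightarrow> h C = h C' \<Longrightarrow> C = C'"
proof -
  show "h C \<in> S" "h C \<subseteq> B" using ring_iso_memE(1)[OF h, of C] C by simp_all
  show "h (C \<inter> C') = h C \<inter> h C'" if "C' \<in> R" "C' \<subseteq> A" for C'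
    using ring_iso_memE(2)[OF h, of C C'] C that by (simp add: below_ring_def)
  show "h (sym_diff C C') = sym_diff (h C) (h C')" if "C' \<in> R" "C' \<subseteq> A" for C'
    using ring_iso_memE(3)[OF h, of C C'] C that by (simp add: below_ring_def)
  show "h A = B" using ring_iso_memE(4)[OF h] by (simp add: below_ring_def)
  show "C = C'" if "C' \<in> R" "C' \<subseteq> A" "h C = h C'" for C'
    using ring_iso_memE(5)[OF h] C that by (simp add: bij_betw_def inj_on_def)
qed

lemma below_ring_iso_surj:
  assumes "h \<in> ring_iso (below_ring R A) (below_ring S B)" "D \<in> S" "D \<subseteq> B"
  obtains C where "C \<in> R" "C \<subseteq> A" "h C = D"
proof -
  have "D \<in> h ` {C \<in> R. C \<subseteq> A}"
    using ring_iso_memE(5)[OF assms(1)] assms(2,3) by (simp add: bij_betw_def)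
  then show thesis using that by blast
qed

context set_ring
begin

lemma below_ring_iso_Diff:
  assumes h: "h \<in> ring_iso (below_ring R A) (below_ring S B)"
    and "C \<in> R" "C \<subseteq> A" "C' \<in> R" "C' \<subseteq> A"
  shows "h (C - C') = h C - h C'"
proof -
  have "C - C' = sym_diff C (C \<inter> C')" by blast
  also have "h \<dots> = sym_diff (h C) (h (C \<inter> C'))"
    using assms by (intro below_ring_iso_sym_diff[OF h]) (auto intro: Int_mem)
  also have "\<dots> = h C - h C'"
    using below_ring_iso_Int[OF h assms(2-)] by blast
  finally show ?thesis .
qed

lemma below_ring_iso_empty:
  assumes h: "h \<in> ring_iso (below_ring R A) (below_ring S B)"
  shows "h {} = {}"
  using below_ring_iso_Diff[OF h, of "{}" "{}"] empty_mem by simp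

lemma below_ring_iso_subset_iff:
  assumes h: "h \<in> ring_iso (below_ring R A) (below_ring S B)"
    and "C \<in> R" "C \<subseteq> A" "C' \<in> R" "C' \<subseteq> A"
  shows "h C \<subseteq> h C' \<longleftrightarrow> C \<subseteq> C'"
proof -
  have "h C \<subseteq> h C' \<longleftrightarrow> h C = h (C \<inter> C')"
    using below_ring_iso_Int[OF h assms(2-)] by blast
  also have "\<dots> \<longleftrightarrow> C = C \<inter> C'"
    using below_ring_iso_inj[OF h, of C "C \<inter> C'"] assms Int_mem[of C C'] by auto
  finally show ?thesis by blast
qed

lemma below_ring_iso_restrict:
  assumes h: "h \<in> ring_iso (below_ring R A) (below_ring S B)"
    and C: "C \<in> R" "C \<subseteq> A"
  shows "h \<in> ring_iso (below_ring R C) (below_ring S (h C))"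
proof (rule below_ring_isoI)
  show "h D \<in> S \<and> h D \<subseteq> h C" if "D \<in> R" "D \<subseteq> C" for D
    using that C below_ring_iso_mem[OF h, of D] below_ring_iso_subset_iff[OF h, of D C] by auto
  show "\<exists>D'\<in>R. D' \<subseteq> C \<and> h D' = D" if D: "D \<in> S" "D \<subseteq> h C" for D
  proof -
    have "D \<subseteq> B" using D below_ring_iso_mem[OF h C] by blast
    then obtain D' where "D' \<in> R" "D' \<subseteq> A" "h D' = D"
      using below_ring_iso_surj[OF h D(1)] by blast
    then show ?thesis
      using below_ring_iso_subset_iff[OF h, of D' C] D C by auto
  qed
  fix D D' assume D: "D \<in> R" "D \<subseteq> C" "D' \<in> R" "D' \<subseteq> C"
  then have A: "D \<subseteq> A" "D' \<subseteq> A" using C by auto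
  show "h D = h D' \<Longrightarrow> D = D'" using below_ring_iso_inj[OF h] D A by blast
  show "h (D \<inter> D') = h D \<inter> h D'" using below_ring_iso_Int[OF h] D A by blast
  show "h (sym_diff D D') = sym_diff (h D) (h D')"
    using below_ring_iso_sym_diff[OF h] D A by blast
qed simp

lemma below_ring_iso_inv:
  assumes h: "h \<in> ring_iso (below_ring R A) (below_ring S B)"
    and A: "A \<in> R"
  obtains g where "g \<in> ring_iso (below_ring S B) (below_ring R A)"
    "\<And>C. C \<in> R \<Longrightarrow> C \<subseteq> A \<Longrightarrow> g (h C) = C" "\<And>D. D \<in> S \<Longrightarrow> D \<subseteq> B \<Longrightarrow> h (g D) = D"
proof -
  define g where "g = inv_into {C \<in> R. C \<subseteq> A} h"
  have bij: "bij_betw h {C \<in> R. C \<subseteq> A} {D \<in> S. D \<subseteq> B}"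
    using ring_iso_memE(5)[OF h] by simp
  have AB: "h A = B" using below_ring_iso_top[OF h empty_mem] by simp
  have gh: "g (h C) = C" if "C \<in> R" "C \<subseteq> A" for C
    unfolding g_def using bij_betw_inv_into_left[OF bij] that by simp
  have hg: "h (g D) = D" if "D \<in> S" "D \<subseteq> B" for D
    unfolding g_def using bij_betw_inv_into_right[OF bij] that by simp
  have mem: "g D \<in> R \<and> g D \<subseteq> A" if "D \<in> S" "D \<subseteq> B" for D
    using below_ring_iso_surj[OF h that] gh by metis
  have sd: "sym_diff C C' \<in> R" if "C \<in> R" "C' \<in> R" for C C'
    using that by (intro Un_mem Diff_mem)
  have "g \<in> ring_iso (below_ring S B) (below_ring R A)"
  proof (rule below_ring_isoI)
    show "g D \<in> R \<and> g D \<subseteq> A" if "D \<in> S" "D \<subseteq> B" for D using mem[OF that] .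
    show "\<exists>D\<in>S. D \<subseteq> B \<and> g D = C" if "C \<in> R" "C \<subseteq> A" for C
      using below_ring_iso_mem[OF h that] gh[OF that] by blast
    show "g B = A"
      using AB gh[of A] A by simp
    fix D D' assume D: "D \<in> S" "D \<subseteq> B" "D' \<in> S" "D' \<subseteq> B"
    show "D = D'" if "g D = g D'" using that hg D by metis
    have "D \<inter> D' = h (g D) \<inter> h (g D')" using hg D by simp
    also have "\<dots> = h (g D \<inter> g D')"
      using mem D by (intro below_ring_iso_Int[OF h, symmetric]) auto
    finally show "g (D \<inter> D') = g D \<inter> g D'" 
      using gh[of "g D \<inter> g D'"] mem D Int_mem by (metis le_infI1)
    have "sym_diff D D' = sym_diff (h (g D)) (h (g D'))" using hg D by simp
    also have "\<dots> = h (sym_diff (g D) (g D'))"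
      using mem D by (intro below_ring_iso_sym_diff[OF h, symmetric]) auto
    moreover have "sym_diff (g D) (g D') \<subseteq> A" using mem D by blast
    ultimately show "g (sym_diff D D') = sym_diff (g D) (g D')" 
      using gh[of "sym_diff (g D) (g D')"] mem[OF D(1,2)] mem[OF D(3,4)] sd by simp
  qed
  then show thesis using that gh hg by blast
qed

end


section \<open>Back-and-forth with finite pairings\<close>

definition pairing ::
    "('a set \<Rightarrow> 'a set \<Rightarrow> bool) \<Rightarrow> 'a set \<Rightarrow> 'a set \<Rightarrow> ('a set \<times> 'a set) set \<Rightarrow> bool"
  where "pairing Rel A B P \<longleftrightarrow> finite P \<and> (\<forall>p\<in>P. Rel (fst p) (snd p)) \<and>
    (\<forall>p\<in>P. \<forall>q\<in>P. p \<noteq> q \<longrightarrow> fst p \<inter> fst q = {} \<and> snd p \<inter> snd q = {}) \<and>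
    \<Union>(fst ` P) = A \<and> \<Union>(snd ` P) = B"

definition pair_refines :: "('a set \<times> 'a set) set \<Rightarrow> ('a set \<times> 'a set) set \<Rightarrow> bool"
  where "pair_refines P' P \<longleftrightarrow> (\<forall>p\<in>P'. \<exists>q\<in>P. fst p \<subseteq> fst q \<and> snd p \<subseteq> snd q)"

definition splits_family :: "'a set set \<Rightarrow> 'a set \<Rightarrow> bool"
  where "splits_family \<U> E \<longleftrightarrow> (\<forall>U\<in>\<U>. U \<subseteq> E \<or> U \<inter> E = {})"

text \<open>A finite approximation to the graph of the isomorphism: once a stage decides that
  \<open>C\<close> corresponds to \<open>D\<close>, no refinement revises it
  (\<open>pair_matches_refines\<close>).\<close>

definition pair_matches :: "('a set \<times> 'a set) set \<Rightarrow> 'a set \<Rightarrow> 'a set \<Rightarrow> bool"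
  where "pair_matches P C D \<longleftrightarrow>
    (\<forall>p\<in>P. fst p \<subseteq> C \<and> snd p \<subseteq> D \<or> fst p \<inter> C = {} \<and> snd p \<inter> D = {})"

lemma pair_refines_trans: "pair_refines P Q \<Longrightarrow> pair_refines Q T \<Longrightarrow> pair_refines P T"
  unfolding pair_refines_def by (meson order_trans)

lemma pair_matches_refines: "pair_matches P C D \<Longrightarrow> pair_refines P' P \<Longrightarrow> pair_matches P' C D"
  unfolding pair_matches_def pair_refines_def by (meson disjoint_iff order_trans subsetD)

lemma pairing_swap:
  assumes sym: "\<And>U V. Rel U V \<Longrightarrow> Rel V U" and "pairing Rel A B P"
  shows "pairing Rel B A (prod.swap ` P)"
proof -
  note P = assms(2)[unfolded pairing_def]
  show ?thesis
    unfolding pairing_def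
  proof (intro conjI ballI impI)
    show "finite (prod.swap ` P)" using P by blast
    show "\<Union>(fst ` prod.swap ` P) = B" "\<Union>(snd ` prod.swap ` P) = A"
      using P by (simp_all only: image_image fst_swap snd_swap)
    show "Rel (fst p) (snd p)" if p: "p \<in> prod.swap ` P" for p
    proof -
      obtain p' where "p' \<in> P" "p = prod.swap p'" using p by blast
      then show ?thesis using P sym by simp
    qed
    fix p q assume "p \<in> prod.swap ` P" "q \<in> prod.swap ` P" "p \<noteq> q"
    then obtain p' q' where "p' \<in> P" "p = prod.swap p'" "q' \<in> P" "q = prod.swap q'" "p' \<noteq> q'"
      by blast
    moreover from this have "fst p' \<inter> fst q' = {} \<and> snd p' \<inter> snd q' = {}"
      using P by blast
    ultimately show "fst p \<inter> fst q = {}" "snd p \<inter> snd q = {}" by simp_all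
  qed
qed

lemma pairing_split_left:
  assumes split: "\<And>U V. Rel U V \<Longrightarrow> \<exists>V'. V' \<subseteq> V \<and> Rel (U \<inter> E) V' \<and> Rel (U - E) (V - V')"
    and P: "pairing Rel A B P"
  obtains P' where "pairing Rel A B P'" "pair_refines P' P" "splits_family (fst ` P') E"
proof -
  have "\<exists>f. \<forall>p\<in>P. f p \<subseteq> snd p \<and> Rel (fst p \<inter> E) (f p) \<and> Rel (fst p - E) (snd p - f p)"
  proof (intro bchoice ballI)
    fix p assume "p \<in> P"
    then have "Rel (fst p) (snd p)" using P by (simp add: pairing_def)
    then show "\<exists>V'. V' \<subseteq> snd p \<and> Rel (fst p \<inter> E) V' \<and> Rel (fst p - E) (snd p - V')"
      by (rule split)
  qed
  then obtain f where f: "\<And>p. p \<in> P \<Longrightarrow> f p \<subseteq> snd p"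
    "\<And>p. p \<in> P \<Longrightarrow> Rel (fst p \<inter> E) (f p)" "\<And>p. p \<in> P \<Longrightarrow> Rel (fst p - E) (snd p - f p)"
    by blast
  define P' where "P' = (\<Union>p\<in>P. {(fst p \<inter> E, f p), (fst p - E, snd p - f p)})"
  have "pairing Rel A B P'"
    unfolding pairing_def
  proof (intro conjI ballI impI)
    show "finite P'" using P by (simp add: P'_def pairing_def)
    show "Rel (fst p) (snd p)" if "p \<in> P'" for p
      using that f by (auto simp: P'_def)
    have sub: "\<exists>q\<in>P. p = (fst q \<inter> E, f q) \<or> p = (fst q - E, snd q - f q)" if "p \<in> P'" for p
      using that by (auto simp: P'_def)
    have disj: "fst p \<inter> fst q = {}" "snd p \<inter> snd q = {}" if "p \<in> P" "q \<in> P" "p \<noteq> q" for p q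
      using P that by (auto simp: pairing_def)
    fix p' q' assume "p' \<in> P'" "q' \<in> P'" and ne: "p' \<noteq> q'"
    obtain p where p: "p \<in> P" "p' = (fst p \<inter> E, f p) \<or> p' = (fst p - E, snd p - f p)"
      using sub[OF \<open>p' \<in> P'\<close>] by blast
    obtain q where q: "q \<in> P" "q' = (fst q \<inter> E, f q) \<or> q' = (fst q - E, snd q - f q)"
      using sub[OF \<open>q' \<in> P'\<close>] by blast
    have p's: "fst p' \<subseteq> fst p" "snd p' \<subseteq> snd p"
      using p(2) f(1)[OF p(1)] by (elim disjE; simp add: Diff_subset)+
    have q's: "fst q' \<subseteq> fst q" "snd q' \<subseteq> snd q"
      using q(2) f(1)[OF q(1)] by (elim disjE; simp add: Diff_subset)+
    have "fst p' \<inter> fst q' = {} \<and> snd p' \<inter> snd q' = {}"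
    proof (cases "p = q")
      case True
      then show ?thesis
        using p(2) q(2) ne by (elim disjE) auto
    next
      case False
      then show ?thesis using disj[OF p(1) q(1)] p's q's by blast
    qed
    then show "fst p' \<inter> fst q' = {}" "snd p' \<inter> snd q' = {}" by blast+
  next
    have "\<Union>(fst ` P') = \<Union>(fst ` P)" by (auto simp: P'_def)
    then show "\<Union>(fst ` P') = A" using P by (simp add: pairing_def)
    have "\<Union>(snd ` P') = \<Union>(snd ` P)" using f(1) by (auto simp: P'_def)
    then show "\<Union>(snd ` P') = B" using P by (simp add: pairing_def)
  qed
  moreover have "pair_refines P' P"
    unfolding pair_refines_def
  proof
    fix p' assume "p' \<in> P'"
    then obtain p where p: "p \<in> P" "p' = (fst p \<inter> E, f p) \<or> p' = (fst p - E, snd p - f p)"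
      unfolding P'_def by blast
    then have "fst p' \<subseteq> fst p \<and> snd p' \<subseteq> snd p"
      using f(1)[OF p(1)] by (elim disjE; simp add: Diff_subset)
    with p(1) show "\<exists>q\<in>P. fst p' \<subseteq> fst q \<and> snd p' \<subseteq> snd q" by blast
  qed
  moreover have "splits_family (fst ` P') E"
    unfolding splits_family_def P'_def by auto
  ultimately show thesis using that by blast
qed

lemma pairing_split_both:
  assumes split: "\<And>U V. Rel U V \<Longrightarrow> \<exists>V'. V' \<subseteq> V \<and> Rel (U \<inter> E) V' \<and> Rel (U - E) (V - V')"
    and sym: "\<And>U V. Rel U V \<Longrightarrow> Rel V U"
    and P: "pairing Rel A B P"
  obtains P' where "pairing Rel A B P'" "pair_refines P' P"
    "splits_family (fst ` P') E" "splits_family (snd ` P') E"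
proof -
  obtain P1 where P1: "pairing Rel A B P1" "pair_refines P1 P" "splits_family (fst ` P1) E"
    using pairing_split_left[where Rel = Rel and E = E, OF split P] by blast
  have "pairing Rel B A (prod.swap ` P1)"
    using pairing_swap[where Rel = Rel, OF sym P1(1)] .
  then obtain P2 where P2: "pairing Rel B A P2" "pair_refines P2 (prod.swap ` P1)"
    "splits_family (fst ` P2) E"
    using pairing_split_left[where Rel = Rel and E = E, OF split] by blast
  show thesis
  proof
    show "pairing Rel A B (prod.swap ` P2)"
      using pairing_swap[where Rel = Rel, OF sym P2(1)] .
    \<comment> \<open>Splitting the right members afterwards only shrinks the left ones, so the
      first splitting survives.\<close>
    have r: "pair_refines (prod.swap ` P2) P1"
      using P2(2) by (force simp: pair_refines_def)
    then show "pair_refines (prod.swap ` P2) P"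
      using P1(2) pair_refines_trans by blast
    show "splits_family (fst ` prod.swap ` P2) E"
      unfolding splits_family_def
    proof
      fix U assume "U \<in> fst ` prod.swap ` P2"
      then obtain q where "q \<in> P1" "U \<subseteq> fst q" using r unfolding pair_refines_def by blast
      then show "U \<subseteq> E \<or> U \<inter> E = {}"
        using P1(3) unfolding splits_family_def by blast
    qed
    show "splits_family (snd ` prod.swap ` P2) E"
      using P2(3) by (simp add: image_image)
  qed
qed

text \<open>A point of \<open>D\<close> lies in some right member; \<open>empty\<close> makes the
  left partner nonempty, and a nonempty set cannot be both inside \<open>C\<close> and disjoint from
  it. So both matches decide this pair alike.\<close>

lemma pair_matches_right_unique:
  assumes empty: "\<And>U V. Rel U V \<Longrightarrow> U = {} \<longleftrightarrow> V = {}"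
    and P: "pairing Rel A B P" and "pair_matches P C D" "pair_matches P C D'" "D \<subseteq> B" "D' \<subseteq> B"
  shows "D = D'"
proof -
  have "D \<subseteq> D'" if D: "pair_matches P C D" "pair_matches P C D'" "D \<subseteq> B" for D D'
  proof
    fix x assume "x \<in> D"
    then obtain p where p: "p \<in> P" "x \<in> snd p" using P D by (auto simp: pairing_def)
    then have "fst p \<noteq> {}" using empty P by (auto simp: pairing_def)
    then show "x \<in> D'"
      using D(1,2) p \<open>x \<in> D\<close> unfolding pair_matches_def by blast
  qed
  with assms(3-6) show ?thesis by blast
qed

lemma pair_matches_swap: "pair_matches (prod.swap ` P) D C \<longleftrightarrow> pair_matches P C D"
  by (auto simp: pair_matches_def)

lemma pair_matches_left_unique:
  assumes empty: "\<And>U V. Rel U V \<Longrightarrow> U = {} \<longleftrightarrow> V = {}"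
    and sym: "\<And>U V. Rel U V \<Longrightarrow> Rel V U"
    and P: "pairing Rel A B P" and "pair_matches P C D" "pair_matches P C' D" "C \<subseteq> A" "C' \<subseteq> A"
  shows "C = C'"
  using pair_matches_right_unique[where Rel = Rel, OF empty pairing_swap[where Rel = Rel, OF sym P]]
    assms(4-) pair_matches_swap by metis

context set_ring
begin

lemma pairing_match_right:
  assumes mem: "\<And>U V. Rel U V \<Longrightarrow> V \<in> R"
    and P: "pairing Rel A B P" and C: "splits_family (fst ` P) C"
  obtains D where "D \<in> R" "D \<subseteq> B" "pair_matches P C D"
proof
  let ?D = "\<Union>(snd ` {p \<in> P. fst p \<subseteq> C})"
  show "?D \<in> R"
    using P mem by (intro Union_mem) (auto simp: pairing_def)
  show "?D \<subseteq> B" using P by (auto simp: pairing_def)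
  show "pair_matches P C ?D"
    unfolding pair_matches_def
  proof
    fix p assume p: "p \<in> P"
    show "fst p \<subseteq> C \<and> snd p \<subseteq> ?D \<or> fst p \<inter> C = {} \<and> snd p \<inter> ?D = {}"
    proof (cases "fst p \<subseteq> C")
      case False
      have "snd p \<inter> snd q = {}" if "q \<in> P" "fst q \<subseteq> C" for q
        using P p that False by (metis pairing_def)
      then have "snd p \<inter> ?D = {}" by blast
      with False C p show ?thesis unfolding splits_family_def by blast
    qed (use p in blast)
  qed
qed

text \<open>Stage \<open>Suc n\<close> splits both sides by the \<open>n\<close>-th element of
  \<open>R\<close>, so every element is eventually matched. Two matches hold together at a later
  stage, hence injectivity and the ring operations are checked in a single finite pairing.\<close>

theorem Vaught_criterion:
  assumes "countable R" and "Rel A B"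
    and mem: "\<And>U V. Rel U V \<Longrightarrow> U \<in> R \<and> V \<in> R"
    and empty: "\<And>U V. Rel U V \<Longrightarrow> U = {} \<longleftrightarrow> V = {}"
    and sym: "\<And>U V. Rel U V \<Longrightarrow> Rel V U"
    and split: "\<And>U V E. Rel U V \<Longrightarrow> E \<in> R \<Longrightarrow>
      \<exists>V'. V' \<subseteq> V \<and> Rel (U \<inter> E) V' \<and> Rel (U - E) (V - V')"
  shows "below_ring R A \<simeq> below_ring R B"
proof -
  define e where "e = from_nat_into R"
  have eR: "e n \<in> R" for n
    unfolding e_def using empty_mem by (intro from_nat_into) auto
  have e_surj: "\<exists>n. e n = C" if "C \<in> R" for C
    unfolding e_def using \<open>countable R\<close> that by (metis from_nat_into_to_nat_on)
  have "pairing Rel A B {(A, B)}" using \<open>Rel A B\<close> by (simp add: pairing_def)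
  then have "\<exists>P. \<forall>n. pairing Rel A B (P n) \<and> pair_refines (P (Suc n)) (P n) \<and>
      splits_family (fst ` P (Suc n)) (e n) \<and> splits_family (snd ` P (Suc n)) (e n)"
    using pairing_split_both[where Rel = Rel, OF split[OF _ eR] sym]
    by (intro dependent_nat_choice) metis+
  then obtain P where P: "\<And>n. pairing Rel A B (P n)"
    and ref: "\<And>n. pair_refines (P (Suc n)) (P n)"
    and splits: "\<And>n. splits_family (fst ` P (Suc n)) (e n)" "\<And>n. splits_family (snd ` P (Suc n)) (e n)"
    by blast
  have match_mono: "pair_matches (P n) C D" if "pair_matches (P m) C D" "m \<le> n" for m n C D
    using that(2,1) by (induction rule: dec_induct) (use ref pair_matches_refines in blast)+
  \<comment> \<open>The graph of the isomorphism. It is total on all of \<open>R\<close>, as only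
    \<open>C \<inter> A\<close> is seen by the pairings; injectivity therefore asks for
    \<open>C \<subseteq> A\<close>.\<close>
  define \<phi> where "\<phi> C D \<longleftrightarrow> D \<in> R \<and> D \<subseteq> B \<and> (\<exists>n. pair_matches (P n) C D)" for C D
  have total: "\<exists>D. \<phi> C D" if C: "C \<in> R" for C
  proof -
    obtain n where "e n = C" using e_surj[OF C] by blast
    then show ?thesis
      using pairing_match_right[where Rel = Rel, OF _ P splits(1)] mem unfolding \<phi>_def by metis
  qed
  have surj: "\<exists>C. C \<in> R \<and> C \<subseteq> A \<and> \<phi> C D" if D: "D \<in> R" "D \<subseteq> B" for D
  proof -
    obtain n where n: "e n = D" using e_surj[OF D(1)] by blast
    have "pairing Rel B A (prod.swap ` P (Suc n))"
      using pairing_swap[where Rel = Rel, OF sym P] .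
    moreover have "splits_family (fst ` prod.swap ` P (Suc n)) D"
      using splits(2)[of n] n by (simp add: image_image)
    ultimately obtain C where "C \<in> R" "C \<subseteq> A" "pair_matches (prod.swap ` P (Suc n)) D C"
      using pairing_match_right[where Rel = Rel] mem by metis
    then show ?thesis using D pair_matches_swap unfolding \<phi>_def by metis
  qed
  have common: "\<exists>n. pair_matches (P n) C D \<and> pair_matches (P n) C' D'"
    if "\<phi> C D" "\<phi> C' D'" for C D C' D'
    using that match_mono unfolding \<phi>_def by (metis nle_le)
  have uniq: "D = D'" if "\<phi> C D" "\<phi> C D'" for C D D'
    using common[OF that] pair_matches_right_unique[where Rel = Rel, OF empty P] that
    unfolding \<phi>_def by metis
  have inj: "C = C'" if "\<phi> C D" "\<phi> C' D" "C \<subseteq> A" "C' \<subseteq> A" for C C' D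
    using common[OF that(1,2)] pair_matches_left_unique[where Rel = Rel, OF empty sym P] that
    by metis
  define h where "h C = (SOME D. \<phi> C D)" for C
  have h: "\<phi> C (h C)" if "C \<in> R" for C
    unfolding h_def using total[OF that] by (rule someI_ex)
  have hI: "h C = D" if "\<phi> C D" "C \<in> R" for C D
    using uniq[OF h that(1)] that(2) by blast
  have "h \<in> ring_iso (below_ring R A) (below_ring R B)"
  proof (rule below_ring_isoI)
    show "h C \<in> R \<and> h C \<subseteq> B" if "C \<in> R" for C
      using h[OF that] by (simp add: \<phi>_def)
    show "\<exists>C\<in>R. C \<subseteq> A \<and> h C = D" if "D \<in> R" "D \<subseteq> B" for D
      using surj[OF that] hI by blast
    have "pair_matches (P 0) A B"
      using P[of 0] by (auto simp: pair_matches_def pairing_def)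
    then show "h A = B"
      using mem[OF \<open>Rel A B\<close>] by (intro hI) (auto simp: \<phi>_def)
    fix C C' assume C: "C \<in> R" "C \<subseteq> A" "C' \<in> R" "C' \<subseteq> A"
    show "C = C'" if "h C = h C'"
      using inj[of C "h C" C'] h C that by metis
    obtain n where n: "pair_matches (P n) C (h C)" "pair_matches (P n) C' (h C')"
      using common h C by blast
    have m: "h C \<in> R" "h C \<subseteq> B" "h C' \<in> R" "h C' \<subseteq> B" using h C by (auto simp: \<phi>_def)
    have "pair_matches (P n) (C \<inter> C') (h C \<inter> h C')"
      using n unfolding pair_matches_def by blast
    then show "h (C \<inter> C') = h C \<inter> h C'"
      using m C by (intro hI) (auto simp: \<phi>_def intro: Int_mem)
    have "pair_matches (P n) (sym_diff C C') (sym_diff (h C) (h C'))"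
      unfolding pair_matches_def
    proof
      fix p assume "p \<in> P n"
      then have "fst p \<subseteq> C \<and> snd p \<subseteq> h C \<or> fst p \<inter> C = {} \<and> snd p \<inter> h C = {}"
        "fst p \<subseteq> C' \<and> snd p \<subseteq> h C' \<or> fst p \<inter> C' = {} \<and> snd p \<inter> h C' = {}"
        using n unfolding pair_matches_def by blast+
      then show "fst p \<subseteq> sym_diff C C' \<and> snd p \<subseteq> sym_diff (h C) (h C') \<or>
          fst p \<inter> sym_diff C C' = {} \<and> snd p \<inter> sym_diff (h C) (h C') = {}"
        by (elim disjE conjE) blast+
    qed
    then show "h (sym_diff C C') = sym_diff (h C) (h C')"
      using m C by (intro hI) (auto simp: \<phi>_def intro!: Un_mem Diff_mem)
  qed
  then show ?thesis unfolding is_ring_iso_def by blast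
qed

end

section \<open>Compact open sets and the Cantor-Bendixson sequence\<close>

lemma compact_opensD:
  "A \<in> compact_opens X \<Longrightarrow> compactin X A" "A \<in> compact_opens X \<Longrightarrow> openin X A"
  "A \<in> compact_opens X \<Longrightarrow> A \<subseteq> topspace X"
  by (auto simp: compact_opens_def dest: openin_subset)

lemma cb_mem_iff: "x \<in> cb X \<xi> \<longleftrightarrow> x \<in> topspace X \<and> (\<forall>\<eta><\<xi>. x \<in> X derived_set_of cb X \<eta>)"
  by (subst cb.simps) blast

lemma perfect_kernel_subset_cb: "perfect_kernel X \<subseteq> cb X \<xi>"
  by (auto simp: perfect_kernel_def)

text \<open>Otherwise \<open>omega1\<close> would be a countable union of countable initial
  segments.\<close>

lemma countable_omega1_bounded:
  fixes T :: "omega1 set"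
  assumes "countable T"
  shows "\<exists>\<xi>. \<forall>\<eta>\<in>T. \<eta> \<le> \<xi>"
proof (rule ccontr)
  assume "\<nexists>\<xi>. \<forall>\<eta>\<in>T. \<eta> \<le> \<xi>"
  then have "UNIV = (\<Union>\<eta>\<in>T. {..<\<eta>})" by (auto simp: not_le)
  then show False
    using assms countable_lessThan_omega1 uncountable_UNIV_omega1 by (metis countable_UN)
qed

section \<open>Compact open sets of an omega-Stone space\<close>

locale omega_stone =
  fixes X :: "'a topology"
  assumes omega_Stone: "omega_Stone_space X"
begin

abbreviation R :: "'a set set" where "R \<equiv> compact_opens X"
abbreviation K :: "'a set" where "K \<equiv> perfect_kernel X"

lemma Hausdorff: "Hausdorff_space X" and locally_compact: "locally_compact_space X"
  and totally_disconnected: "totally_disconnected_space X" and second_countable: "second_countable X"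
  using omega_Stone by (simp_all add: omega_Stone_space_def)

lemma compact_open_closedin: "A \<in> R \<Longrightarrow> closedin X A"
  using compactin_imp_closedin[OF Hausdorff] compact_opensD by blast

text \<open>The component of \<open>x\<close> is the compact set \<open>{x}\<close>, so Wilder's
  theorem on components of locally compact Hausdorff spaces puts a clopen \<open>N\<close> around it
  inside any neighbourhood; being closed in the compact \<open>M\<close>, it is compact.\<close>

lemma compact_open_base:
  assumes "openin X U" "x \<in> U"
  obtains N where "N \<in> R" "x \<in> N" "N \<subseteq> U"
proof -
  have x: "x \<in> topspace X" using assms openin_subset by blast
  then obtain V M where VM: "openin X V" "compactin X M" "x \<in> V" "V \<subseteq> M"
    using locally_compact unfolding locally_compact_space_def by blast
  have "connectedin X (connected_component_of_set X x)"
    by (rule connectedin_connected_component_of)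
  then obtain a where "connected_component_of_set X x \<subseteq> {a}"
    using totally_disconnected unfolding totally_disconnected_space_def by blast
  moreover have "x \<in> connected_component_of_set X x"
    using x by (simp add: connected_component_of_refl)
  ultimately have "connected_component_of_set X x = {x}" by auto
  then have "{x} \<in> connected_components_of X"
    using x by (metis connected_component_in_connected_components_of)
  then obtain N N' where N: "openin X N" "openin X N'" "disjnt N N'" "N \<union> N' = topspace X"
    "{x} \<subseteq> N" "N \<subseteq> U \<inter> V"
    using wilder_locally_compact_component_thm[OF locally_compact Hausdorff, of "{x}" "U \<inter> V"]
      assms VM x by (metis IntI compactin_sing empty_subsetI insert_subset openin_Int)
  have "N = topspace X - N'" using N by (auto simp: disjnt_def)
  then have "closedin X N" using N(2) by blast
  then have "compactin X N" using closed_compactin[OF VM(2)] N VM(4) by blast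
  then show thesis using that N by (auto simp: compact_opens_def)
qed

sublocale set_ring R
proof
  show "{} \<in> R" by (simp add: compact_opens_def)
  fix A B assume "A \<in> R" "B \<in> R"
  then show "A \<union> B \<in> R" by (auto simp: compact_opens_def intro: compactin_Un)
  show "A - B \<in> R"
    using \<open>A \<in> R\<close> \<open>B \<in> R\<close> compact_open_closedin[of A] compact_open_closedin[of B]
      closed_compactin[of X A "A - B"]
    by (auto simp: compact_opens_def intro: openin_diff closedin_diff)
qed

lemma compact_open_between:
  assumes "compactin X C" "openin X U" "C \<subseteq> U"
  obtains N where "N \<in> R" "C \<subseteq> N" "N \<subseteq> U"
proof -
  have "\<exists>F. finite F \<and> F \<subseteq> {N \<in> R. N \<subseteq> U} \<and> C \<subseteq> \<Union>F"
  proof (rule compactinD[OF assms(1)])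
    show "openin X N" if "N \<in> {N \<in> R. N \<subseteq> U}" for N
      using that compact_opensD by blast
    show "C \<subseteq> \<Union>{N \<in> R. N \<subseteq> U}"
      using compact_open_base[OF assms(2)] assms(3) by blast
  qed
  then obtain F where F: "finite F" "F \<subseteq> {N \<in> R. N \<subseteq> U}" "C \<subseteq> \<Union>F" by blast
  show thesis
    by (rule that[of "\<Union>F"]) (use F in \<open>auto intro: Union_mem\<close>)
qed

text \<open>By compactness each element is a finite union of members of a countable base.\<close>

lemma countable_compact_opens: "countable R"
proof -
  obtain \<B> where \<B>: "countable \<B>" "\<And>V. V \<in> \<B> \<Longrightarrow> openin X V"
    "\<And>U x. openin X U \<Longrightarrow> x \<in> U \<Longrightarrow> \<exists>V\<in>\<B>. x \<in> V \<and> V \<subseteq> U"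
    using second_countable unfolding second_countable_def by metis
  have "A \<in> Union ` {F. finite F \<and> F \<subseteq> \<B>}" if A: "A \<in> R" for A
  proof -
    have "\<exists>F. finite F \<and> F \<subseteq> {V \<in> \<B>. V \<subseteq> A} \<and> A \<subseteq> \<Union>F"
    proof (rule compactinD[OF compact_opensD(1)[OF A]])
      show "openin X V" if "V \<in> {V \<in> \<B>. V \<subseteq> A}" for V
        using that \<B>(2) by simp
      show "A \<subseteq> \<Union>{V \<in> \<B>. V \<subseteq> A}"
        using \<B>(3)[OF compact_opensD(2)[OF A]] by blast
    qed
    then obtain F where "finite F" "F \<subseteq> {V \<in> \<B>. V \<subseteq> A}" "A \<subseteq> \<Union>F" by blast
    then have "A = \<Union>F" "F \<subseteq> \<B>" by auto
    then show ?thesis using \<open>finite F\<close> by blast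
  qed
  then show ?thesis
    by (intro countable_subset[OF subsetI countable_image[OF countable_Collect_finite_subset[OF \<B>(1)]]])
qed

lemma closedin_cb: "closedin X (cb X \<xi>)"
proof -
  let ?\<D> = "insert (topspace X) ((\<lambda>\<eta>. X derived_set_of cb X \<eta>) ` {..<\<xi>})"
  have "closedin X (\<Inter>?\<D>)"
  proof (rule closedin_Inter)
    show "closedin X S" if "S \<in> ?\<D>" for S
      using that closedin_derived_set_of[OF Hausdorff] closedin_topspace by blast
  qed simp
  moreover have "cb X \<xi> = \<Inter>?\<D>"
    by (subst cb.simps) blast
  ultimately show ?thesis by simp
qed

lemma closedin_kernel: "closedin X K"
  unfolding perfect_kernel_def by (rule closedin_Inter) (auto intro: closedin_cb)

text \<open>Limits at points of \<open>A\<close> can be tested inside the ring below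
  \<open>A\<close>, so an isomorphism of such rings can see them. \<open>closure_base_iff\<close>
  serves the same end.\<close>

lemma derived_set_base_iff:
  assumes "A \<in> R" "x \<in> A"
  shows "x \<in> X derived_set_of S \<longleftrightarrow> (\<forall>E\<in>R. x \<in> E \<longrightarrow> E \<subseteq> A \<longrightarrow> (\<exists>y\<in>E. y \<noteq> x \<and> y \<in> S))"
    (is "_ = ?rhs")
proof
  assume "x \<in> X derived_set_of S"
  then show ?rhs
    unfolding in_derived_set_of using compact_opensD(2) by blast
next
  assume r: ?rhs
  show "x \<in> X derived_set_of S"
    unfolding in_derived_set_of
  proof (intro conjI allI impI)
    show "x \<in> topspace X" using assms compact_opensD(3) by blast
    fix T assume "x \<in> T \<and> openin X T"
    then have "openin X (T \<inter> A)" "x \<in> T \<inter> A"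
      using assms compact_opensD(2) by (auto intro: openin_Int)
    then obtain E where "E \<in> R" "x \<in> E" "E \<subseteq> T \<inter> A" using compact_open_base by metis
    with r show "\<exists>y. y \<noteq> x \<and> y \<in> S \<and> y \<in> T" by blast
  qed
qed

lemma closure_base_iff:
  assumes "A \<in> R" "x \<in> A"
  shows "x \<in> X closure_of S \<longleftrightarrow> (\<forall>E\<in>R. x \<in> E \<longrightarrow> E \<subseteq> A \<longrightarrow> E \<inter> S \<noteq> {})"
    (is "_ = ?rhs")
proof
  assume "x \<in> X closure_of S"
  then show ?rhs
    unfolding in_closure_of using compact_opensD(2) by blast
next
  assume r: ?rhs
  show "x \<in> X closure_of S"
    unfolding in_closure_of
  proof (intro conjI allI impI)
    show "x \<in> topspace X" using assms compact_opensD(3) by blast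
    fix T assume "x \<in> T \<and> openin X T"
    then have "openin X (T \<inter> A)" "x \<in> T \<inter> A"
      using assms compact_opensD(2) by (auto intro: openin_Int)
    then obtain E where "E \<in> R" "x \<in> E" "E \<subseteq> T \<inter> A" using compact_open_base by metis
    with r show "\<exists>y. y \<in> S \<and> y \<in> T" by blast
  qed
qed

text \<open>The first term that omits \<open>x\<close> does so because \<open>x\<close> is not a
  limit of an earlier term; by minimality \<open>x\<close> still lies in that term, where it is
  isolated. The one-clause recursion for \<open>cb\<close> spares separate successor and limit
  cases.\<close>

lemma isolated_outside_kernel:
  assumes "x \<in> topspace X" "x \<notin> K"
  obtains a N where "N \<in> R" "N \<inter> cb X a = {x}"
proof -
  obtain \<xi> where "x \<notin> cb X \<xi>" using assms by (auto simp: perfect_kernel_def)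
  define \<xi>' where "\<xi>' = (LEAST \<xi>. x \<notin> cb X \<xi>)"
  have "x \<notin> cb X \<xi>'" unfolding \<xi>'_def using \<open>x \<notin> cb X \<xi>\<close> by (rule LeastI)
  then obtain a where a: "a < \<xi>'" "x \<notin> X derived_set_of cb X a"
    using assms(1) by (auto simp: cb_mem_iff)
  then have "x \<in> cb X a" using not_less_Least unfolding \<xi>'_def by blast
  obtain A where A: "A \<in> R" "x \<in> A"
    using compact_open_base[OF openin_topspace assms(1)] .
  then obtain E where "E \<in> R" "x \<in> E" "\<forall>y\<in>E. y = x \<or> y \<notin> cb X a"
    using a(2) derived_set_base_iff[OF A, of "cb X a"] by metis
  then have "E \<inter> cb X a = {x}" using \<open>x \<in> cb X a\<close> by blast
  with \<open>E \<in> R\<close> show thesis by (rule that)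
qed

text \<open>If \<open>U \<inter> cb X a\<close> had no isolated point it would be dense in itself,
  survive every later term and so lie in \<open>K\<close>.\<close>

lemma isolated_in_open:
  assumes "openin X U" "U \<inter> K = {}" "U \<inter> cb X a \<noteq> {}"
  obtains N z where "N \<in> R" "N \<subseteq> U" "N \<inter> cb X a = {z}"
proof -
  have "\<exists>z\<in>U \<inter> cb X a. z \<notin> X derived_set_of cb X a"
  proof (rule ccontr)
    assume none: "\<not> ?thesis"
    have "U \<inter> cb X a \<subseteq> cb X \<xi>" for \<xi>
    proof (induction \<xi> rule: less_induct)
      case (less \<xi>)
      show ?case
      proof
        fix z assume z: "z \<in> U \<inter> cb X a"
        have "z \<in> X derived_set_of cb X \<eta>" if \<eta>: "\<eta> < \<xi>" for \<eta>
        proof -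
          have "z \<in> X derived_set_of (U \<inter> cb X a)"
            using none z openin_Int_derived_set_of_subset[OF assms(1), of "cb X a"] by blast
          then show ?thesis using derived_set_of_mono[OF less[OF \<eta>]] by blast
        qed
        then show "z \<in> cb X \<xi>" using z cb_subset_topspace by (fastforce simp: cb_mem_iff[of z X \<xi>])
      qed
    qed
    then have "U \<inter> cb X a \<subseteq> K" unfolding perfect_kernel_def by blast
    then show False using assms by blast
  qed
  then obtain z where z: "z \<in> U" "z \<in> cb X a" "z \<notin> X derived_set_of cb X a" by blast
  obtain A where A: "A \<in> R" "z \<in> A" "A \<subseteq> U" using compact_open_base[OF assms(1) z(1)] .
  obtain E where "E \<in> R" "z \<in> E" "E \<subseteq> A" "\<forall>y\<in>E. y = z \<or> y \<notin> cb X a"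
    using z(3) derived_set_base_iff[OF A(1,2), of "cb X a"] by metis
  then have "E \<inter> cb X a = {z}" "E \<subseteq> U" using A(3) z(2) by blast+
  with \<open>E \<in> R\<close> show thesis using that by blast
qed

text \<open>Sets \<open>N x\<close> that isolate \<open>x\<close> in some term are distinct for
  distinct points, since of any two terms one contains the other. As \<open>R\<close> is countable,
  only countably many points lie off \<open>K\<close>, and indices of terms that omit them have an
  upper bound in \<open>omega1\<close>.\<close>

lemma cb_stabilizes: "\<exists>\<xi>. cb X \<xi> = K"
proof -
  let ?S = "topspace X - K"
  have "\<exists>N. \<forall>x\<in>?S. N x \<in> R \<and> (\<exists>a. N x \<inter> cb X a = {x})"
  proof (intro bchoice ballI)
    fix x assume "x \<in> ?S"
    then have "x \<in> topspace X" "x \<notin> K" by simp_all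
    then obtain a N where "N \<in> R" "N \<inter> cb X a = {x}"
      by (rule isolated_outside_kernel)
    then show "\<exists>N. N \<in> R \<and> (\<exists>a. N \<inter> cb X a = {x})" by blast
  qed
  then obtain N where N: "\<And>x. x \<in> ?S \<Longrightarrow> N x \<in> R" "\<And>x. x \<in> ?S \<Longrightarrow> \<exists>a. N x \<inter> cb X a = {x}"
    by metis
  have "inj_on N ?S"
  proof (rule inj_onI)
    fix x y assume xy: "x \<in> ?S" "y \<in> ?S" "N x = N y"
    obtain a b where ab: "N x \<inter> cb X a = {x}" "N x \<inter> cb X b = {y}"
      using N(2)[OF xy(1)] N(2)[OF xy(2)] xy(3) by auto
    have "y \<in> {x} \<or> x \<in> {y}"
    proof (cases "a \<le> b")
      case True
      then show ?thesis using cb_antimono[of a b X] ab by blast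
    next
      case False
      then show ?thesis using cb_antimono[of b a X] ab by force
    qed
    then show "x = y" by auto
  qed
  moreover have "countable (N ` ?S)"
    using countable_subset[OF _ countable_compact_opens] N(1) by blast
  ultimately have "countable ?S" using countable_image_inj_on by blast
  have "\<exists>g. \<forall>x\<in>?S. x \<notin> cb X (g x)"
    by (rule bchoice) (auto simp: perfect_kernel_def)
  then obtain g where g: "\<And>x. x \<in> ?S \<Longrightarrow> x \<notin> cb X (g x)" by blast
  obtain \<xi> where \<xi>: "\<forall>\<eta>\<in>g ` ?S. \<eta> \<le> \<xi>"
    using countable_omega1_bounded[of "g ` ?S"] \<open>countable ?S\<close> by blast
  have "cb X \<xi> \<subseteq> K"
  proof
    fix x assume x: "x \<in> cb X \<xi>"
    show "x \<in> K"
    proof (rule ccontr)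
      assume "x \<notin> K"
      then have "x \<in> ?S" using x cb_subset_topspace[of X \<xi>] by blast
      then have "g x \<le> \<xi>" "x \<notin> cb X (g x)" using g \<xi> by simp_all
      then show False using cb_antimono[of "g x" \<xi> X] x by blast
    qed
  qed
  then show ?thesis using perfect_kernel_subset_cb[of X] by blast
qed

text \<open>A relatively open \<open>E\<close> extends to an open \<open>U\<close>, and compactness
  fits a member \<open>N\<close> of \<open>R\<close> between \<open>E\<close> and
  \<open>U\<close>.\<close>

lemma kernel_ring_eq: "kernel_ring X = (\<inter>) K ` R"
proof (intro equalityI subsetI)
  fix E assume "E \<in> kernel_ring X"
  then have E: "compactin X E" "E \<subseteq> K" and "openin (subtopology X K) E"
    by (auto simp: kernel_ring_def compact_opens_def compactin_subtopology)
  then obtain U where U: "openin X U" "E = U \<inter> K" by (auto simp: openin_subtopology)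
  then obtain N where "N \<in> R" "E \<subseteq> N" "N \<subseteq> U"
    using compact_open_between[OF E(1)] by blast
  then have "E = K \<inter> N" using U by blast
  with \<open>N \<in> R\<close> show "E \<in> (\<inter>) K ` R" by blast
next
  fix E assume "E \<in> (\<inter>) K ` R"
  then obtain N where "N \<in> R" "E = K \<inter> N" by blast
  then show "E \<in> kernel_ring X"
    using closed_Int_compactin[OF closedin_kernel, of N]
    by (auto simp: kernel_ring_def compact_opens_def compactin_subtopology openin_subtopology)
qed

end

section \<open>Finite disjoint sums\<close>

text \<open>The finite disjoint families of \<open>primitive_ring\<close>, in a form that allows
  induction summand by summand; \<open>finite_sum_iff\<close> translates.\<close>

inductive finite_sum :: "('a set \<Rightarrow> bool) \<Rightarrow> 'a set \<Rightarrow> bool" for Q where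
  finite_sum_empty: "finite_sum Q {}"
| finite_sum_insert: "Q P \<Longrightarrow> finite_sum Q A \<Longrightarrow> P \<inter> A = {} \<Longrightarrow> finite_sum Q (P \<union> A)"

lemma finite_sum_single: "Q P \<Longrightarrow> finite_sum Q P"
  using finite_sum_insert[OF _ finite_sum_empty, of Q P] by simp

lemma finite_sum_Un:
  "finite_sum Q A \<Longrightarrow> finite_sum Q B \<Longrightarrow> A \<inter> B = {} \<Longrightarrow> finite_sum Q (A \<union> B)"
proof (induction rule: finite_sum.induct)
  case (finite_sum_insert P A)
  then have "finite_sum Q (A \<union> B)" "P \<inter> (A \<union> B) = {}" by blast+
  with finite_sum_insert.hyps(1) have "finite_sum Q (P \<union> (A \<union> B))"
    by (rule finite_sum.finite_sum_insert)
  then show ?case by (simp add: Un_assoc)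
qed simp

lemma finite_sum_iff:
  "finite_sum Q A \<longleftrightarrow> (\<exists>F. finite F \<and> disjoint F \<and> \<Union>F = A \<and> (\<forall>P\<in>F. Q P))"
proof
  assume "finite_sum Q A"
  then show "\<exists>F. finite F \<and> disjoint F \<and> \<Union>F = A \<and> (\<forall>P\<in>F. Q P)"
  proof (induction rule: finite_sum.induct)
    case finite_sum_empty
    show ?case by (intro exI[of _ "{}"]) simp
  next
    case (finite_sum_insert P A)
    then obtain F where F: "finite F" "disjoint F" "\<Union>F = A" "\<forall>P\<in>F. Q P" by blast
    have "disjnt P D" if "D \<in> F" for D
      using that F(3) finite_sum_insert.hyps(3) unfolding disjnt_def by blast
    then have "disjoint (insert P F)"
      using F(2) by (simp add: pairwise_insert disjnt_sym)
    then show ?case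
      using F finite_sum_insert.hyps(1) by (intro exI[of _ "insert P F"]) simp
  qed
next
  assume "\<exists>F. finite F \<and> disjoint F \<and> \<Union>F = A \<and> (\<forall>P\<in>F. Q P)"
  then obtain F where F: "finite F" "disjoint F" "\<Union>F = A" "\<forall>P\<in>F. Q P" by blast
  have "finite_sum Q (\<Union>F)"
    using F(1,2,4)
  proof (induction F rule: finite_induct)
    case (insert P F)
    have "disjnt P D" if "D \<in> F" for D
      using that insert.prems(1) insert.hyps(2) by (auto simp: pairwise_insert)
    then have "P \<inter> \<Union>F = {}" unfolding disjnt_def by blast
    moreover have "finite_sum Q (\<Union>F)"
      using insert.prems by (intro insert.IH) (simp_all add: pairwise_insert)
    ultimately have "finite_sum Q (P \<union> \<Union>F)"
      using insert.prems(2) by (intro finite_sum_insert) simp_all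
    then show ?case by simp
  qed (simp add: finite_sum_empty)
  with F(3) show "finite_sum Q A" by simp
qed

text \<open>Splitting a matched pair yields several matched pairs; closing under sums turns this
  into a splitting within one relation.\<close>

inductive sum_rel :: "('a set \<Rightarrow> 'a set \<Rightarrow> bool) \<Rightarrow> 'a set \<Rightarrow> 'a set \<Rightarrow> bool" for Q where
  sum_rel_empty: "sum_rel Q {} {}"
| sum_rel_insert: "Q A B \<Longrightarrow> sum_rel Q A' B' \<Longrightarrow> A \<inter> A' = {} \<Longrightarrow> B \<inter> B' = {} \<Longrightarrow>
    sum_rel Q (A \<union> A') (B \<union> B')"

lemma sum_rel_single: "Q A B \<Longrightarrow> sum_rel Q A B"
  using sum_rel_insert[OF _ sum_rel_empty, of Q A B] by simp

lemma sum_rel_Un: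
  "sum_rel Q A B \<Longrightarrow> sum_rel Q A' B' \<Longrightarrow> A \<inter> A' = {} \<Longrightarrow> B \<inter> B' = {} \<Longrightarrow>
    sum_rel Q (A \<union> A') (B \<union> B')"
proof (induction rule: sum_rel.induct)
  case (sum_rel_insert A1 B1 A2 B2)
  then have "sum_rel Q (A2 \<union> A') (B2 \<union> B')" "A1 \<inter> (A2 \<union> A') = {}" "B1 \<inter> (B2 \<union> B') = {}"
    by blast+
  with sum_rel_insert.hyps(1) have "sum_rel Q (A1 \<union> (A2 \<union> A')) (B1 \<union> (B2 \<union> B'))"
    by (rule sum_rel.sum_rel_insert)
  then show ?case by (simp add: Un_assoc)
qed simp

lemma sum_rel_sym:
  assumes "\<And>A B. Q A B \<Longrightarrow> Q B A" and "sum_rel Q A B"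
  shows "sum_rel Q B A"
  using assms(2)
proof (induction rule: sum_rel.induct)
  case (sum_rel_insert A B A' B')
  then have "Q B A" "B \<inter> B' = {}" "A \<inter> A' = {}" using assms(1) by blast+
  with sum_rel_insert.IH show ?case
    by (intro sum_rel.sum_rel_insert)
qed (rule sum_rel_empty)

text \<open>Splittings of the summands add up, so it is enough to split the generating pairs, even
  if only into sums.\<close>

lemma sum_rel_split:
  assumes "\<And>A B. Q A B \<Longrightarrow> \<exists>V\<subseteq>B. sum_rel Q (A \<inter> E) V \<and> sum_rel Q (A - E) (B - V)"
    and "sum_rel Q A B"
  shows "\<exists>V\<subseteq>B. sum_rel Q (A \<inter> E) V \<and> sum_rel Q (A - E) (B - V)"
  using assms(2)
proof (induction rule: sum_rel.induct)
  case sum_rel_empty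
  show ?case using sum_rel.sum_rel_empty[of Q] by auto
next
  case (sum_rel_insert A B A' B')
  obtain V where V: "V \<subseteq> B" "sum_rel Q (A \<inter> E) V" "sum_rel Q (A - E) (B - V)"
    using assms(1)[OF sum_rel_insert.hyps(1)] by blast
  obtain V' where V': "V' \<subseteq> B'" "sum_rel Q (A' \<inter> E) V'" "sum_rel Q (A' - E) (B' - V')"
    using sum_rel_insert.IH by blast
  have "sum_rel Q ((A \<inter> E) \<union> (A' \<inter> E)) (V \<union> V')"
    using V(2) V'(2) by (rule sum_rel_Un) (use sum_rel_insert.hyps(3,4) V(1) V'(1) in blast)+
  moreover have "sum_rel Q ((A - E) \<union> (A' - E)) ((B - V) \<union> (B' - V'))"
    using V(3) V'(3) by (rule sum_rel_Un) (use sum_rel_insert.hyps(3,4) in blast)+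
  moreover have "(A \<inter> E) \<union> (A' \<inter> E) = (A \<union> A') \<inter> E" "(A - E) \<union> (A' - E) = (A \<union> A') - E"
    "(B - V) \<union> (B' - V') = (B \<union> B') - (V \<union> V')"
    using V(1) V'(1) sum_rel_insert.hyps(4) by blast+
  ultimately have "sum_rel Q ((A \<union> A') \<inter> E) (V \<union> V')"
    "sum_rel Q ((A \<union> A') - E) ((B \<union> B') - (V \<union> V'))" by simp_all
  moreover have "V \<union> V' \<subseteq> B \<union> B'" using V(1) V'(1) by blast
  ultimately show ?case by blast
qed

section \<open>Tight sets and their cores\<close>

context omega_stone
begin

text \<open>
  For \<open>C = K\<close> the points of \<open>C\<close> in \<open>limits_off C \<xi>\<close> are those of rank greater than \<open>\<xi>\<close>. A second
  kind of core is needed for scattered sets: \<open>C = {p}\<close>, which lies in \<open>limits_off C \<xi>\<close> iff \<open>\<xi>\<close> is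
  less than the Cantor-Bendixson rank of \<open>p\<close>.
\<close>

definition limits_off :: "'a set \<Rightarrow> omega1 \<Rightarrow> 'a set"
  where "limits_off C \<xi> = X closure_of (cb X \<xi> - C)"

definition tight :: "'a set \<Rightarrow> 'a set \<Rightarrow> bool"
  where "tight C A \<longleftrightarrow> (\<forall>\<xi>. A \<inter> cb X \<xi> \<subseteq> C \<or> C \<inter> A \<inter> limits_off C \<xi> \<noteq> {})"

definition trace :: "'a set \<Rightarrow> 'a set set"
  where "trace C = (\<inter>) C ` R"

text \<open>Preserving which sets \<open>limits_off\<close> are met stands in for preserving a
  measure, as \<open>C\<close> and \<open>D\<close> may be different cores. For
  \<open>C = D = K\<close> it follows from equality of rank measures by
  \<open>rank_measure_le_iff\<close>.\<close>

definition core_match :: "'a set \<Rightarrow> 'a set \<Rightarrow> ('a set \<Rightarrow> 'a set) \<Rightarrow> 'a set \<Rightarrow> 'a set \<Rightarrow> bool"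
  where "core_match C D h A B \<longleftrightarrow>
    h \<in> ring_iso (below_ring (trace C) (C \<inter> A)) (below_ring (trace D) (D \<inter> B)) \<and>
    (\<forall>E\<in>trace C. E \<subseteq> C \<inter> A \<longrightarrow> (\<forall>\<xi>. E \<inter> limits_off C \<xi> = {} \<longleftrightarrow> h E \<inter> limits_off D \<xi> = {}))"

text \<open>The inclusion \<open>A \<inter> K \<subseteq> C\<close> guarantees that compact open
  parts of \<open>A - C\<close> are scattered.\<close>

definition core :: "'a set \<Rightarrow> 'a set \<Rightarrow> bool"
  where "core C A \<longleftrightarrow> A \<in> R \<and> closedin X C \<and> A \<inter> K \<subseteq> C \<and> tight C A"

definition matched :: "'a set \<Rightarrow> 'a set \<Rightarrow> bool"
  where "matched A B \<longleftrightarrow> (\<exists>C D h. core C A \<and> core D B \<and> core_match C D h A B)"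

text \<open>Compact scattered pieces of Cantor-Bendixson rank \<open>a\<close> and degree one, in
  the sense of the Mazurkiewicz-Sierpinski classification of countable compact spaces.\<close>

definition singular :: "omega1 \<Rightarrow> 'a set \<Rightarrow> bool"
  where "singular a P \<longleftrightarrow> P \<in> R \<and> (\<exists>p. P \<inter> cb X a = {p})"

lemma set_ring_trace: "set_ring (trace C)"
proof
  show "{} \<in> trace C" unfolding trace_def using empty_mem by blast
  fix A B assume "A \<in> trace C" "B \<in> trace C"
  then obtain A' B' where "A' \<in> R" "B' \<in> R" "A = C \<inter> A'" "B = C \<inter> B'"
    unfolding trace_def by blast
  then have "A \<union> B = C \<inter> (A' \<union> B')" "A - B = C \<inter> (A' - B')" "A' \<union> B' \<in> R" "A' - B' \<in> R"
    by (auto intro: Un_mem Diff_mem)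
  then show "A \<union> B \<in> trace C" "A - B \<in> trace C" unfolding trace_def by blast+
qed

lemma trace_mem: "A \<in> R \<Longrightarrow> C \<inter> A \<in> trace C"
  by (simp add: trace_def)

lemma trace_below:
  assumes "E \<in> trace C" "E \<subseteq> C \<inter> A" "A \<in> R"
  obtains E' where "E' \<in> R" "E' \<subseteq> A" "E = C \<inter> E'"
proof -
  obtain E1 where "E1 \<in> R" "E = C \<inter> E1" using assms(1) unfolding trace_def by blast
  then show thesis using that[of "E1 \<inter> A"] assms Int_mem by blast
qed

lemma limits_off_antimono: "\<eta> \<le> \<xi> \<Longrightarrow> limits_off C \<xi> \<subseteq> limits_off C \<eta>"
  unfolding limits_off_def by (intro closure_of_mono Diff_mono cb_antimono) auto

lemma limits_off_subset_cb: "limits_off C \<xi> \<subseteq> cb X \<xi>"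
  unfolding limits_off_def using closedin_cb by (intro closure_of_minimal) auto

lemma diff_subset_limits_off: "cb X \<xi> - C \<subseteq> limits_off C \<xi>"
  unfolding limits_off_def using cb_subset_topspace[of X \<xi>] by (intro closure_of_subset) blast

lemma limits_off_meets:
  assumes "openin X U" "U \<inter> limits_off C \<xi> \<noteq> {}"
  shows "U \<inter> cb X \<xi> - C \<noteq> {}"
proof -
  have "U \<inter> (cb X \<xi> - C) \<noteq> {}"
    using assms openin_Int_closure_of_eq_empty[OF assms(1), of "cb X \<xi> - C"]
    unfolding limits_off_def by blast
  then show ?thesis by blast
qed

text \<open>At the ordinal 0, here \<open>z\<close>, the term is the whole space, so tightness
  without core points leaves no points at all. Vaught's criterion needs this for pairs with one
  empty side.\<close>

lemma tight_empty_core: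
  assumes "tight C A" "C \<inter> A = {}" "A \<in> R"
  shows "A = {}"
proof -
  define z :: omega1 where "z = (LEAST \<xi>. True)"
  have "z \<le> \<eta>" for \<eta> unfolding z_def by (rule Least_le) simp
  then have "cb X z = topspace X" by (intro cb_zero)
  then have "A \<subseteq> cb X z" using compact_opensD(3)[OF assms(3)] by simp
  moreover have "A \<inter> cb X z \<subseteq> C" using assms(1,2) unfolding tight_def by blast
  ultimately show ?thesis using assms(2) by blast
qed

text \<open>At the least \<open>\<xi>\<close> where no core point of \<open>A\<close> is a limit,
  the points of \<open>A \<inter> cb X \<xi>\<close> off \<open>C\<close> form a compact set, and a
  compact open \<open>S\<close> swallows them without touching \<open>C\<close>. Earlier terms keep
  their limits in the core, as \<open>limits_off\<close> is taken in the whole space.\<close>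

lemma trim:
  assumes "A \<in> R" "closedin X C"
  obtains S where "S \<in> R" "S \<subseteq> A - C" "tight C (A - S)"
proof (cases "\<exists>\<xi>. C \<inter> A \<inter> limits_off C \<xi> = {}")
  case False
  then have "tight C (A - {})" by (auto simp: tight_def)
  then show thesis using that[of "{}"] empty_mem by blast
next
  case True
  define \<xi> where "\<xi> = (LEAST \<xi>. C \<inter> A \<inter> limits_off C \<xi> = {})"
  have \<xi>: "C \<inter> A \<inter> limits_off C \<xi> = {}"
    using True unfolding \<xi>_def by (metis (mono_tags, lifting) LeastI)
  have less: "C \<inter> A \<inter> limits_off C \<eta> \<noteq> {}" if "\<eta> < \<xi>" for \<eta>
    using not_less_Least[of \<eta> "\<lambda>\<xi>. C \<inter> A \<inter> limits_off C \<xi> = {}"] that unfolding \<xi>_def by blast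
  have eq: "limits_off C \<xi> \<inter> A = A \<inter> cb X \<xi> - C"
    using \<xi> limits_off_subset_cb[of C \<xi>] diff_subset_limits_off[of \<xi> C] by blast
  have "compactin X (limits_off C \<xi> \<inter> A)"
    unfolding limits_off_def using compact_opensD(1)[OF assms(1)]
    by (intro closed_Int_compactin) simp_all
  moreover have "openin X (A - C)"
    using compact_opensD(2)[OF assms(1)] assms(2) by (rule openin_diff)
  ultimately obtain S where S: "S \<in> R" "limits_off C \<xi> \<inter> A \<subseteq> S" "S \<subseteq> A - C"
    using eq by (elim compact_open_between[of _ "A - C"]) auto
  have "tight C (A - S)"
    unfolding tight_def
  proof
    fix \<eta>
    show "(A - S) \<inter> cb X \<eta> \<subseteq> C \<or> C \<inter> (A - S) \<inter> limits_off C \<eta> \<noteq> {}"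
    proof (cases "\<eta> < \<xi>")
      case True
      then show ?thesis using less[OF True] S(3) by blast
    next
      case False
      then have "cb X \<eta> \<subseteq> cb X \<xi>" by (intro cb_antimono) simp
      then show ?thesis using S(2) eq by blast
    qed
  qed
  with S show thesis using that by blast
qed

text \<open>Compactness. The local assumption passes to all smaller elements, so that the overlaps
  of a finite cover can be cut away.\<close>

lemma finite_sum_local:
  assumes A: "A \<in> R"
    and loc: "\<And>x. x \<in> A \<Longrightarrow> \<exists>N\<in>R. x \<in> N \<and> (\<forall>E\<in>R. E \<subseteq> N \<longrightarrow> finite_sum Q E)"
  shows "finite_sum Q A"
proof -
  let ?\<U> = "{N \<in> R. \<forall>E\<in>R. E \<subseteq> N \<longrightarrow> finite_sum Q E}"
  have "\<exists>F. finite F \<and> F \<subseteq> ?\<U> \<and> A \<subseteq> \<Union>F"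
  proof (rule compactinD[OF compact_opensD(1)[OF A]])
    show "openin X N" if "N \<in> ?\<U>" for N using that compact_opensD(2) by blast
    show "A \<subseteq> \<Union>?\<U>" using loc by blast
  qed
  then obtain F where F: "finite F" "F \<subseteq> ?\<U>" "A \<subseteq> \<Union>F" by blast
  from F A show ?thesis
  proof (induction F arbitrary: A rule: finite_induct)
    case empty
    then show ?case by (simp add: finite_sum_empty)
  next
    case (insert N F)
    then have N: "N \<in> R" "\<forall>E\<in>R. E \<subseteq> N \<longrightarrow> finite_sum Q E" by simp_all
    have "A - N \<subseteq> \<Union>F" using insert.prems(2) by blast
    then have "finite_sum Q (A - N)"
      using insert.prems N(1) by (intro insert.IH) (auto intro: Diff_mem)
    moreover have "finite_sum Q (A \<inter> N)"
      using N insert.prems(3) Int_mem by simp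
    ultimately have "finite_sum Q ((A \<inter> N) \<union> (A - N))" by (intro finite_sum_Un) blast+
    moreover have "(A \<inter> N) \<union> (A - N) = A" by blast
    ultimately show ?case by simp
  qed
qed

text \<open>Induction on \<open>a\<close>: a compact open part of \<open>N\<close> that misses
  \<open>z\<close> misses the whole \<open>a\<close>-th term, so each of its points is isolated in
  an earlier term.\<close>

lemma scattered_finite_sum:
  assumes "A \<in> R" "A \<inter> K = {}"
  shows "finite_sum (\<lambda>P. \<exists>a. singular a P) A"
proof (rule finite_sum_local[OF assms(1)])
  have *: "finite_sum (\<lambda>P. \<exists>a. singular a P) E"
    if "N \<in> R" "N \<inter> cb X a = {z}" "E \<in> R" "E \<subseteq> N" for N a z E
    using that
  proof (induction a arbitrary: N z E rule: less_induct)
    case (less a)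
    show ?case
    proof (cases "z \<in> E")
      case True
      then have "E \<inter> cb X a = {z}" using less.prems by blast
      then show ?thesis using less.prems(3) by (intro finite_sum_single) (auto simp: singular_def)
    next
      case False
      have "E \<inter> cb X a \<subseteq> {z}" using less.prems(2,4) by blast
      with False have E: "E \<inter> cb X a = {}" by auto
      show ?thesis
      proof (rule finite_sum_local[OF less.prems(3)])
        fix w assume "w \<in> E"
        then have "w \<in> topspace X" "w \<notin> K"
          using E compact_opensD(3)[OF less.prems(3)] perfect_kernel_subset_cb[of X a] by blast+
        then obtain b N' where N': "N' \<in> R" "N' \<inter> cb X b = {w}"
          by (rule isolated_outside_kernel)
        have "b < a"
        proof (rule ccontr)
          assume "\<not> b < a"
          then have "cb X b \<subseteq> cb X a" by (intro cb_antimono) simp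
          then show False using N' E \<open>w \<in> E\<close> by blast
        qed
        then show "\<exists>N\<in>R. w \<in> N \<and> (\<forall>E\<in>R. E \<subseteq> N \<longrightarrow> finite_sum (\<lambda>P. \<exists>a. singular a P) E)"
          using less.IH N' by (intro bexI[of _ N']) auto
      qed
    qed
  qed
  fix x assume "x \<in> A"
  then have "x \<in> topspace X" "x \<notin> K" using assms compact_opensD(3) by blast+
  then obtain a N where "N \<in> R" "N \<inter> cb X a = {x}" by (rule isolated_outside_kernel)
  then show "\<exists>N\<in>R. x \<in> N \<and> (\<forall>E\<in>R. E \<subseteq> N \<longrightarrow> finite_sum (\<lambda>P. \<exists>a. singular a P) E)"
    using * by (intro bexI[of _ N]) auto
qed

end

section \<open>Sets with isomorphic cores are isomorphic\<close>

context omega_stone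
begin

lemma core_match_sym:
  assumes "core_match C D h A B" "A \<in> R"
  obtains g where "core_match D C g B A"
proof -
  note h = conjunct1[OF assms(1)[unfolded core_match_def]]
  obtain g where g: "g \<in> ring_iso (below_ring (trace D) (D \<inter> B)) (below_ring (trace C) (C \<inter> A))"
    "\<And>E. E \<in> trace D \<Longrightarrow> E \<subseteq> D \<inter> B \<Longrightarrow> h (g E) = E"
    using set_ring.below_ring_iso_inv[OF set_ring_trace h trace_mem[OF assms(2)]] by metis
  have "core_match D C g B A"
    unfolding core_match_def
  proof (intro conjI ballI impI allI)
    fix E \<xi> assume E: "E \<in> trace D" "E \<subseteq> D \<inter> B"
    have "g E \<in> trace C" "g E \<subseteq> C \<inter> A" using below_ring_iso_mem[OF g(1) E] .
    then have "g E \<inter> limits_off C \<xi> = {} \<longleftrightarrow> h (g E) \<inter> limits_off D \<xi> = {}"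
      using assms(1) unfolding core_match_def by blast
    then show "E \<inter> limits_off D \<xi> = {} \<longleftrightarrow> g E \<inter> limits_off C \<xi> = {}"
      using g(2)[OF E] by simp
  qed (rule g(1))
  then show thesis by (rule that)
qed

lemma matched_sym: "matched A B \<Longrightarrow> matched B A"
  unfolding matched_def core_def using core_match_sym by metis

lemma matched_mem: "matched A B \<Longrightarrow> A \<in> R \<and> B \<in> R"
  by (auto simp: matched_def core_def)

lemma matched_empty:
  assumes "matched A B" "A = {}"
  shows "B = {}"
proof -
  obtain C D h where B: "core D B" and m: "core_match C D h A B"
    using assms unfolding matched_def by blast
  note h = conjunct1[OF m[unfolded core_match_def]]
  have "D \<inter> B = h (C \<inter> A)"
    using below_ring_iso_top[OF h set_ring.empty_mem[OF set_ring_trace]] by simp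
  also have "\<dots> = {}"
    using set_ring.below_ring_iso_empty[OF set_ring_trace h] assms(2) by simp
  finally show ?thesis using tight_empty_core B unfolding core_def by blast
qed

text \<open>The condition on \<open>V\<close> concerns \<open>D \<inter> V\<close> alone, so
  \<open>V\<close> may gain or lose sets off \<open>D\<close> without disturbing the match.\<close>

lemma core_match_restrict:
  assumes m: "core_match C D h A B" and "U \<in> R" "U \<subseteq> A" and V: "D \<inter> V = h (C \<inter> U)"
  shows "core_match C D h U V"
proof -
  note h = conjunct1[OF m[unfolded core_match_def]]
  have U: "C \<inter> U \<in> trace C" "C \<inter> U \<subseteq> C \<inter> A" using assms trace_mem by blast+
  show ?thesis
    unfolding core_match_def V
  proof (intro conjI ballI impI)
    show "h \<in> ring_iso (below_ring (trace C) (C \<inter> U)) (below_ring (trace D) (h (C \<inter> U)))"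
      by (rule set_ring.below_ring_iso_restrict[OF set_ring_trace h U])
    fix E assume "E \<in> trace C" "E \<subseteq> C \<inter> U"
    then show "\<forall>\<xi>. E \<inter> limits_off C \<xi> = {} \<longleftrightarrow> h E \<inter> limits_off D \<xi> = {}"
      using m U(2) unfolding core_match_def by blast
  qed
qed

text \<open>With one-point cores the rings of traces have two elements, and \<open>p\<close> is a
  limit of other points of \<open>cb X \<xi>\<close> exactly when \<open>\<xi> < a\<close>. So
  \<open>a\<close> is the only invariant.\<close>

lemma singular_matched:
  assumes "singular a P" "singular a Q"
  shows "matched P Q"
proof -
  obtain p where p: "P \<in> R" "P \<inter> cb X a = {p}" using assms(1) by (auto simp: singular_def)
  obtain q where q: "Q \<in> R" "Q \<inter> cb X a = {q}" using assms(2) by (auto simp: singular_def)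
  have lim: "{p} \<inter> limits_off {p} \<xi> = {} \<longleftrightarrow> a \<le> \<xi>" if p: "P \<in> R" "P \<inter> cb X a = {p}" for P p \<xi>
  proof
    assume e: "{p} \<inter> limits_off {p} \<xi> = {}"
    show "a \<le> \<xi>"
    proof (rule ccontr)
      assume "\<not> a \<le> \<xi>"
      then have "\<xi> < a" by simp
      moreover have "p \<in> cb X a" using p(2) by blast
      ultimately have "p \<in> X derived_set_of cb X \<xi>" using cb_mem_iff[of p X a] by blast
      moreover have P: "p \<in> P" using p(2) by blast
      ultimately have "\<forall>E\<in>R. p \<in> E \<longrightarrow> E \<subseteq> P \<longrightarrow> E \<inter> (cb X \<xi> - {p}) \<noteq> {}"
        using derived_set_base_iff[OF p(1) P] by blast
      then have "p \<in> limits_off {p} \<xi>"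
        unfolding limits_off_def using closure_base_iff[OF p(1) P] by blast
      with e show False by blast
    qed
  next
    assume "a \<le> \<xi>"
    then have "P \<inter> cb X \<xi> - {p} = {}" using cb_antimono[of a \<xi> X] p(2) by blast
    then have "P \<inter> limits_off {p} \<xi> = {}"
      using limits_off_meets[OF compact_opensD(2)[OF p(1)]] by blast
    then show "{p} \<inter> limits_off {p} \<xi> = {}" using p(2) by blast
  qed
  have core: "core {p} P" if p: "P \<in> R" "P \<inter> cb X a = {p}" for P p
    unfolding core_def tight_def
  proof (intro conjI allI)
    show "P \<in> R" by fact
    have "p \<in> topspace X" using p compact_opensD(3)[OF p(1)] by blast
    then show "closedin X {p}" by (intro compactin_imp_closedin[OF Hausdorff]) simp
    show "P \<inter> K \<subseteq> {p}" using perfect_kernel_subset_cb[of X a] p(2) by blast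
    fix \<xi>
    show "P \<inter> cb X \<xi> \<subseteq> {p} \<or> {p} \<inter> P \<inter> limits_off {p} \<xi> \<noteq> {}"
    proof (cases "a \<le> \<xi>")
      case True
      then show ?thesis using cb_antimono[of a \<xi> X] p(2) by blast
    next
      case False
      then show ?thesis using lim[OF p, of \<xi>] p(2) by blast
    qed
  qed
  have tr: "E \<in> trace {p} \<and> E \<subseteq> {p} \<inter> P \<longleftrightarrow> E = {} \<or> E = {p}"
    if p: "P \<in> R" "P \<inter> cb X a = {p}" for P p E
  proof -
    have "{p} \<inter> P = {p}" using p(2) by blast
    moreover have "{} \<in> trace {p}" by (rule set_ring.empty_mem[OF set_ring_trace])
    moreover have "{p} \<in> trace {p}" using trace_mem[OF p(1), of "{p}"] calculation by simp
    ultimately show ?thesis by auto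
  qed
  define h where "h E = (if E = {} then {} else {q})" for E :: "'a set"
  have "core_match {p} {q} h P Q"
    unfolding core_match_def
  proof (intro conjI ballI impI allI)
    show "h \<in> ring_iso (below_ring (trace {p}) ({p} \<inter> P)) (below_ring (trace {q}) ({q} \<inter> Q))"
    proof (rule below_ring_isoI)
      show "h C \<in> trace {q} \<and> h C \<subseteq> {q} \<inter> Q" for C
        using tr[OF q, of "h C"] unfolding h_def by auto
      show "\<exists>C\<in>trace {p}. C \<subseteq> {p} \<inter> P \<and> h C = D" if "D \<in> trace {q}" "D \<subseteq> {q} \<inter> Q" for D
      proof -
        have "D = {} \<or> D = {q}" using tr[OF q] that by blast
        then have "h (if D = {} then {} else {p}) = D" by (auto simp: h_def)
        moreover have "(if D = {} then {} else {p}) \<in> trace {p} \<and> (if D = {} then {} else {p}) \<subseteq> {p} \<inter> P"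
          using tr[OF p, of "if D = {} then {} else {p}"] by simp
        ultimately show ?thesis by blast
      qed
      have "{p} \<inter> P = {p}" "{q} \<inter> Q = {q}" using p q by blast+
      then show "h ({p} \<inter> P) = {q} \<inter> Q" by (simp add: h_def)
      fix C C' assume "C \<in> trace {p}" "C \<subseteq> {p} \<inter> P" "C' \<in> trace {p}" "C' \<subseteq> {p} \<inter> P"
      then have C: "C = {} \<or> C = {p}" "C' = {} \<or> C' = {p}" using tr[OF p] by blast+
      show "h C = h C' \<Longrightarrow> C = C'" using C by (elim disjE) (simp_all add: h_def)
      show "h (C \<inter> C') = h C \<inter> h C'" using C by (elim disjE) (simp_all add: h_def)
      show "h (sym_diff C C') = sym_diff (h C) (h C')" using C by (elim disjE) (simp_all add: h_def)
    qed
    fix E \<xi> assume "E \<in> trace {p}" "E \<subseteq> {p} \<inter> P"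
    then have "E = {} \<or> E = {p}" using tr[OF p] by blast
    then show "E \<inter> limits_off {p} \<xi> = {} \<longleftrightarrow> h E \<inter> limits_off {q} \<xi> = {}"
      using lim[OF p, of \<xi>] lim[OF q, of \<xi>] by (elim disjE) (simp_all add: h_def)
  qed
  then show ?thesis using core[OF p] core[OF q] unfolding matched_def by blast
qed

text \<open>
  Near a point of \<open>limits_off D a\<close> there are isolated points of the \<open>a\<close>-th term of the sequence,
  which provide partners for the singular summands of \<open>S\<close>; removing these from \<open>H\<close> does not
  change \<open>D \<inter> H\<close>.
\<close>

lemma carve:
  assumes S: "finite_sum (\<lambda>P. \<exists>a. singular a P) S"
    and ranks: "\<And>a. S \<inter> cb X a \<noteq> {} \<Longrightarrow> D \<inter> H \<inter> limits_off D a \<noteq> {}"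
    and H: "H \<in> R" and D: "closedin X D" "H \<inter> K \<subseteq> D"
  shows "\<exists>Q\<in>R. Q \<subseteq> H - D \<and> sum_rel matched S Q"
  using S ranks
proof (induction rule: finite_sum.induct)
  case finite_sum_empty
  show ?case using empty_mem sum_rel_empty[of matched] by auto
next
  case (finite_sum_insert P S)
  then obtain Q where Q: "Q \<in> R" "Q \<subseteq> H - D" "sum_rel matched S Q"
    by (meson Un_iff disjoint_iff)
  obtain a where a: "singular a P" using finite_sum_insert.hyps(1) by blast
  then have "P \<inter> cb X a \<noteq> {}" by (auto simp: singular_def)
  then have "(P \<union> S) \<inter> cb X a \<noteq> {}" by blast
  then have "D \<inter> H \<inter> limits_off D a \<noteq> {}" by (rule finite_sum_insert.prems)
  then have "(H - Q) \<inter> limits_off D a \<noteq> {}" using Q(2) by blast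
  moreover have HQ: "openin X (H - Q)" using H Q(1) Diff_mem compact_opensD(2) by blast
  ultimately have "(H - Q) \<inter> cb X a - D \<noteq> {}" by (intro limits_off_meets)
  then have "(H - Q - D) \<inter> cb X a \<noteq> {}" by blast
  moreover have "openin X (H - Q - D)" using HQ D(1) by (rule openin_diff)
  moreover have "(H - Q - D) \<inter> K = {}" using D(2) by blast
  ultimately obtain N z where N: "N \<in> R" "N \<subseteq> H - Q - D" "N \<inter> cb X a = {z}"
    using isolated_in_open by metis
  then have "matched P N" using singular_matched[OF a, of N] by (simp add: singular_def)
  moreover have "N \<inter> Q = {}" using N(2) by blast
  ultimately have "sum_rel matched (P \<union> S) (N \<union> Q)"
    using Q(3) finite_sum_insert.hyps(3) by (intro sum_rel_insert)
  moreover have "N \<union> Q \<in> R" "N \<union> Q \<subseteq> H - D" using N Q Un_mem by auto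
  ultimately show ?case by blast
qed

text \<open>
  Since \<open>V\<close> has all the ranks of \<open>A\<close>, it stays tight when it absorbs scattered sets or loses
  singular ones, so \<open>B - G\<close> can make up for the scattered excess of \<open>U\<close> and of the lift of
  \<open>h (C \<inter> U)\<close>.
\<close>

lemma matched_split_dominated:
  assumes A: "core C A" and B: "core D B" and m: "core_match C D h A B"
    and UV: "U \<in> R" "V \<in> R" "U \<inter> V = {}" "A = U \<union> V"
    and dom: "\<And>\<xi>. C \<inter> U \<inter> limits_off C \<xi> \<noteq> {} \<Longrightarrow> C \<inter> V \<inter> limits_off C \<xi> \<noteq> {}"
  shows "\<exists>G\<subseteq>B. sum_rel matched U G \<and> sum_rel matched V (B - G)"
proof -
  note h = conjunct1[OF m[unfolded core_match_def]]
  have C: "closedin X C" "A \<inter> K \<subseteq> C" "tight C A" "A \<in> R" using A by (simp_all add: core_def)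
  have D: "closedin X D" "B \<inter> K \<subseteq> D" "tight D B" "B \<in> R" using B by (simp_all add: core_def)
  have lim: "E \<inter> limits_off C \<xi> = {} \<longleftrightarrow> h E \<inter> limits_off D \<xi> = {}"
    if "E \<in> trace C" "E \<subseteq> C \<inter> A" for E \<xi>
    using m that unfolding core_match_def by blast
  have V_dom: "C \<inter> V \<inter> limits_off C \<xi> \<noteq> {}" if "C \<inter> A \<inter> limits_off C \<xi> \<noteq> {}" for \<xi>
    using dom[of \<xi>] that UV(4) by blast
  have V_rank: "C \<inter> V \<inter> limits_off C \<xi> \<noteq> {}" if "\<not> A \<inter> cb X \<xi> \<subseteq> C" for \<xi>
    using V_dom C(3) that unfolding tight_def by blast
  have "tight C V"
    unfolding tight_def using V_rank UV(4) by blast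
  then have V: "core C V" using C UV unfolding core_def by blast
  \<comment> \<open>\<open>U\<close> need not be tight; its surplus \<open>S\<close> is matched
    separately, with the \<open>Q\<close> carved out below.\<close>
  obtain S where S: "S \<in> R" "S \<subseteq> U - C" "tight C (U - S)"
    using trim[OF UV(1) C(1)] by blast
  have U: "core C (U - S)" using S C UV Diff_mem unfolding core_def by blast
  have tU: "C \<inter> U \<in> trace C" "C \<inter> U \<subseteq> C \<inter> A" and tV: "C \<inter> V \<in> trace C" "C \<inter> V \<subseteq> C \<inter> A"
    and tA: "C \<inter> A \<in> trace C"
    using UV C(4) trace_mem by auto
  have hA: "h (C \<inter> A) = D \<inter> B" by (rule below_ring_iso_top[OF h tU])
  \<comment> \<open>Any lift of \<open>h (C \<inter> U)\<close> will do; its scattered excess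
    \<open>T\<close> is handed over to the partner of \<open>V\<close>.\<close>
  obtain G where G: "G \<in> R" "G \<subseteq> B" "h (C \<inter> U) = D \<inter> G"
    using trace_below[OF below_ring_iso_mem[OF h tU] D(4)] by blast
  have "C \<inter> V = C \<inter> A - C \<inter> U" using UV by blast
  then have hV: "h (C \<inter> V) = D \<inter> (B - G)"
    using set_ring.below_ring_iso_Diff[OF set_ring_trace h tA order_refl tU] hA G(3) by auto
  obtain T where T: "T \<in> R" "T \<subseteq> G - D" "tight D (G - T)"
    using trim[OF G(1) D(1)] by blast
  \<comment> \<open>What \<open>G - T\<close> leaves of \<open>B\<close>. As \<open>T\<close> is off
    \<open>D\<close>, the core part of \<open>H\<close> is that of \<open>B - G\<close>, namely the
    image of \<open>C \<inter> V\<close>.\<close>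
  define H where "H = B - (G - T)"
  have H: "H \<in> R" "D \<inter> H = h (C \<inter> V)"
    unfolding H_def hV using D(4) G T Diff_mem by auto
  have SK: "S \<inter> K = {}" using S(2) C(2) UV(4) by blast
  have "\<exists>Q\<in>R. Q \<subseteq> H - D \<and> sum_rel matched S Q"
  proof (rule carve[OF scattered_finite_sum[OF S(1) SK]])
    fix a assume "S \<inter> cb X a \<noteq> {}"
    then have "\<not> A \<inter> cb X a \<subseteq> C" using S(2) UV(4) by blast
    then show "D \<inter> H \<inter> limits_off D a \<noteq> {}"
      using V_rank[of a] lim[OF tV, of a] H(2) by simp
  qed (use H(1) D H_def in auto)
  then obtain Q where Q: "Q \<in> R" "Q \<subseteq> H - D" "sum_rel matched S Q" by blast
  have DH: "D \<inter> (H - Q) = h (C \<inter> V)" using Q(2) H(2) by blast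
  have "tight D (H - Q)"
    unfolding tight_def
  proof
    fix \<xi>
    show "(H - Q) \<inter> cb X \<xi> \<subseteq> D \<or> D \<inter> (H - Q) \<inter> limits_off D \<xi> \<noteq> {}"
    proof (cases "B \<inter> cb X \<xi> \<subseteq> D")
      case True
      then show ?thesis unfolding H_def by blast
    next
      case False
      \<comment> \<open>A limit in \<open>D \<inter> B\<close> gives one in
        \<open>C \<inter> A\<close> through \<open>h\<close>, then one in
        \<open>C \<inter> V\<close> by domination, and through \<open>h\<close> again one in
        \<open>D \<inter> (H - Q)\<close>.\<close>
      then have "D \<inter> B \<inter> limits_off D \<xi> \<noteq> {}" using D(3) unfolding tight_def by blast
      then have "C \<inter> A \<inter> limits_off C \<xi> \<noteq> {}"
        using lim[OF tA order_refl, of \<xi>] hA by simp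
      then have "C \<inter> V \<inter> limits_off C \<xi> \<noteq> {}" by (rule V_dom)
      then show ?thesis using lim[OF tV, of \<xi>] DH by simp
    qed
  qed
  then have H0: "core D (H - Q)"
    using D H(1) Q(1) Diff_mem unfolding core_def H_def by blast
  have G0: "core D (G - T)" using T D G Diff_mem unfolding core_def by blast
  have "C \<inter> (U - S) = C \<inter> U" "D \<inter> (G - T) = D \<inter> G" using S(2) T(2) by blast+
  then have "core_match C D h (U - S) (G - T)"
    using U UV(4) G(3) by (intro core_match_restrict[OF m]) (auto simp: core_def)
  then have "sum_rel matched (U - S) (G - T)"
    using U G0 unfolding matched_def by (intro sum_rel_single) blast
  then have "sum_rel matched ((U - S) \<union> S) ((G - T) \<union> Q)"
    using Q(3) by (rule sum_rel_Un) (use Q(2) H_def in auto)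
  moreover have "(U - S) \<union> S = U" using S(2) by blast
  ultimately have 1: "sum_rel matched U ((G - T) \<union> Q)" by simp
  have "core_match C D h V (H - Q)"
    using UV DH by (intro core_match_restrict[OF m]) auto
  then have "sum_rel matched V (H - Q)"
    using V H0 unfolding matched_def by (intro sum_rel_single) blast
  moreover have "H - Q = B - ((G - T) \<union> Q)" unfolding H_def by blast
  ultimately have "sum_rel matched V (B - ((G - T) \<union> Q))" by simp
  moreover have "(G - T) \<union> Q \<subseteq> B" using G(2) Q(2) unfolding H_def by blast
  ultimately show ?thesis using 1 by blast
qed

text \<open>Initial segments of \<open>omega1\<close> are comparable, so one half dominates. If it
  is \<open>A \<inter> E\<close>, a partner is found for the other half first and \<open>V\<close>
  is its complement in \<open>B\<close>.\<close>

lemma matched_split: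
  assumes "matched A B" "E \<in> R"
  shows "\<exists>V\<subseteq>B. sum_rel matched (A \<inter> E) V \<and> sum_rel matched (A - E) (B - V)"
proof -
  obtain C D h where m: "core C A" "core D B" "core_match C D h A B"
    using assms(1) unfolding matched_def by blast
  have A: "A \<in> R" using m(1) by (simp add: core_def)
  have U: "A \<inter> E \<in> R" and V: "A - E \<in> R" using A assms(2) by (simp_all add: Int_mem Diff_mem)
  let ?L = "\<lambda>U \<xi>. C \<inter> U \<inter> limits_off C \<xi> \<noteq> {}"
  have down: "?L U \<eta>" if "?L U \<xi>" "\<eta> \<le> \<xi>" for U \<xi> \<eta>
    using limits_off_antimono[OF that(2), of C] that(1) by blast
  show ?thesis
  proof (cases "\<forall>\<xi>. ?L (A \<inter> E) \<xi> \<longrightarrow> ?L (A - E) \<xi>")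
    case True
    then show ?thesis
      using matched_split_dominated[OF m U V] by blast
  next
    case False
    then obtain \<eta> where \<eta>: "?L (A \<inter> E) \<eta>" "\<not> ?L (A - E) \<eta>" by blast
    have "?L (A \<inter> E) \<xi>" if "?L (A - E) \<xi>" for \<xi>
    proof -
      have "\<not> \<eta> \<le> \<xi>" using down[OF that, of \<eta>] \<eta>(2) by blast
      then show ?thesis using down[OF \<eta>(1), of \<xi>] by simp
    qed
    then obtain G where G: "G \<subseteq> B" "sum_rel matched (A - E) G" "sum_rel matched (A \<inter> E) (B - G)"
      using matched_split_dominated[OF m V U] by blast
    then have "B - (B - G) = G" by blast
    with G show ?thesis by (intro exI[of _ "B - G"]) auto
  qed
qed

lemma matched_imp_iso:
  assumes "matched A B"
  shows "below_ring R A \<simeq> below_ring R B"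
proof (rule Vaught_criterion[where Rel = "sum_rel matched", OF countable_compact_opens])
  show "sum_rel matched A B" using assms by (rule sum_rel_single)
  fix U V assume UV: "sum_rel matched U V"
  show "sum_rel matched V U" using sum_rel_sym[OF matched_sym UV] .
  show "U \<in> R \<and> V \<in> R"
    using UV by (induction rule: sum_rel.induct) (use matched_mem empty_mem Un_mem in auto)
  show "U = {} \<longleftrightarrow> V = {}"
    using UV by (induction rule: sum_rel.induct) (use matched_empty matched_sym in blast)+
  show "\<exists>V'. V' \<subseteq> V \<and> sum_rel matched (U \<inter> E) V' \<and> sum_rel matched (U - E) (V - V')"
    if "E \<in> R" for E
    using sum_rel_split[OF matched_split[OF _ that] UV] .
qed

end

section \<open>The rank measure and lifting from the kernel\<close>

context omega_stone
begin

text \<open>Where the sequence has reached \<open>K\<close> nothing is left off \<open>K\<close>, so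
  the \<open>LEAST\<close> in \<open>rank_fun\<close> is attained; all larger ordinals follow
  because \<open>limits_off\<close> decreases.\<close>

lemma rank_fun_le_iff:
  assumes "x \<in> K"
  shows "rank_fun X x \<le> \<xi> \<longleftrightarrow> x \<notin> limits_off K \<xi>"
proof -
  obtain \<zeta> where "cb X \<zeta> = K" using cb_stabilizes by blast
  then have "x \<notin> limits_off K \<zeta>" by (simp add: limits_off_def)
  then have "x \<notin> limits_off K (rank_fun X x)"
    unfolding rank_fun_def limits_off_def by (rule LeastI)
  moreover have "x \<notin> limits_off K \<xi> \<Longrightarrow> rank_fun X x \<le> \<xi>"
    unfolding rank_fun_def limits_off_def by (rule Least_le)
  ultimately show ?thesis using limits_off_antimono[of "rank_fun X x" \<xi> K] by blast
qed

text \<open>Translates the measure into the language of \<open>core_match\<close>. An ordinal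
  \<open>\<zeta>\<close> at which the sequence has reached \<open>K\<close> bounds all ranks, so the
  \<open>LEAST\<close> is a true supremum.\<close>

lemma rank_measure_le_iff:
  assumes "E \<subseteq> K"
  shows "rank_measure X E \<le> Some \<xi> \<longleftrightarrow> E \<inter> limits_off K \<xi> = {}"
proof (cases "E = {}")
  case True
  then show ?thesis by (simp add: rank_measure_def)
next
  case False
  obtain \<zeta> where "cb X \<zeta> = K" using cb_stabilizes by blast
  then have "limits_off K \<zeta> = {}" by (simp add: limits_off_def)
  then have bound: "\<forall>x\<in>E. Some (rank_fun X x) \<le> Some \<zeta>"
    using assms rank_fun_le_iff[of _ \<zeta>] by auto
  have eq: "rank_measure X E = (LEAST u. \<forall>x\<in>E. Some (rank_fun X x) \<le> u)"
    using False by (simp add: rank_measure_def)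
  have "\<forall>x\<in>E. Some (rank_fun X x) \<le> rank_measure X E"
    unfolding eq by (rule LeastI[of "\<lambda>u. \<forall>x\<in>E. Some (rank_fun X x) \<le> u", OF bound])
  moreover have "rank_measure X E \<le> Some \<xi>" if "\<forall>x\<in>E. Some (rank_fun X x) \<le> Some \<xi>"
    unfolding eq using that by (rule Least_le)
  ultimately have "rank_measure X E \<le> Some \<xi> \<longleftrightarrow> (\<forall>x\<in>E. Some (rank_fun X x) \<le> Some \<xi>)"
    by (meson order_trans)
  also have "\<dots> \<longleftrightarrow> E \<inter> limits_off K \<xi> = {}"
    using assms rank_fun_le_iff[of _ \<xi>] by auto
  finally show ?thesis .
qed

lemma kernel_ring_trace: "kernel_ring X = trace K"
  by (simp add: kernel_ring_eq trace_def)

text \<open>A part \<open>B\<close> whose trace is measure-isomorphic to that of \<open>P\<close>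
  inherits tightness: its points off \<open>K\<close> belong to \<open>P\<close>, which therefore
  has a limit in \<open>K\<close>, and the isomorphism yields one in \<open>B\<close>. So
  \<open>B\<close> and \<open>P\<close> are matched with core \<open>K\<close>.\<close>

lemma kernel_pseudo_indecomposable:
  assumes P: "P \<in> R" "tight K P"
    and PI: "measure_pseudo_indecomposable (kernel_ring X) (rank_measure X) (K \<inter> P)"
  shows "pseudo_indecomposable R P"
proof -
  have *: "below_ring R B \<simeq> below_ring R P"
    if B: "B \<in> R" "B \<subseteq> P" and iso: "measure_iso (kernel_ring X) (rank_measure X) (K \<inter> B) (K \<inter> P)" for B
  proof -
    obtain h where h: "h \<in> ring_iso (below_ring (trace K) (K \<inter> B)) (below_ring (trace K) (K \<inter> P))"
      and \<sigma>: "\<And>E. E \<in> trace K \<Longrightarrow> E \<subseteq> K \<inter> B \<Longrightarrow> rank_measure X (h E) = rank_measure X E"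
      using iso unfolding measure_iso_def kernel_ring_trace by auto
    have m: "core_match K K h B P"
      unfolding core_match_def
    proof (intro conjI ballI impI allI)
      fix E \<xi> assume E: "E \<in> trace K" "E \<subseteq> K \<inter> B"
      then have "E \<subseteq> K" "h E \<subseteq> K" using below_ring_iso_mem[OF h E] by blast+
      then show "E \<inter> limits_off K \<xi> = {} \<longleftrightarrow> h E \<inter> limits_off K \<xi> = {}"
        using rank_measure_le_iff \<sigma>[OF E] by metis
    qed (rule h)
    have tB: "K \<inter> B \<in> trace K" by (rule trace_mem[OF B(1)])
    have hB: "h (K \<inter> B) = K \<inter> P" by (rule below_ring_iso_top[OF h tB order_refl])
    have "tight K B"
      unfolding tight_def
    proof
      fix \<xi>
      have "K \<inter> B \<inter> limits_off K \<xi> = {} \<longleftrightarrow> K \<inter> P \<inter> limits_off K \<xi> = {}"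
        using m tB hB unfolding core_match_def by (metis order_refl)
      then show "B \<inter> cb X \<xi> \<subseteq> K \<or> K \<inter> B \<inter> limits_off K \<xi> \<noteq> {}"
        using P(2) B(2) unfolding tight_def by blast
    qed
    then have "core K B" "core K P" using P B(1) closedin_kernel by (auto simp: core_def)
    then show ?thesis using m by (intro matched_imp_iso) (auto simp: matched_def)
  qed
  show ?thesis
    unfolding pseudo_indecomposable_def
  proof (intro ballI impI)
    fix B assume B: "B \<in> R" "B \<subseteq> P"
    have "K \<inter> B \<in> kernel_ring X" "K \<inter> B \<subseteq> K \<inter> P"
      using trace_mem[OF B(1)] B(2) by (auto simp: kernel_ring_trace)
    then have "measure_iso (kernel_ring X) (rank_measure X) (K \<inter> B) (K \<inter> P) \<or>
        measure_iso (kernel_ring X) (rank_measure X) (K \<inter> P - K \<inter> B) (K \<inter> P)"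
      using PI unfolding measure_pseudo_indecomposable_def by blast
    moreover have "K \<inter> P - K \<inter> B = K \<inter> (P - B)" by blast
    ultimately show "below_ring R B \<simeq> below_ring R P \<or> below_ring R (P - B) \<simeq> below_ring R P"
      using *[OF B] *[of "P - B"] Diff_mem[OF P(1) B(1)] by auto
  qed
qed

text \<open>Whichever of \<open>B\<close> and \<open>P - B\<close> keeps the point of the
  \<open>a\<close>-th term is again singular for \<open>a\<close>.\<close>

lemma singular_pseudo_indecomposable:
  assumes "singular a P"
  shows "pseudo_indecomposable R P"
  unfolding pseudo_indecomposable_def
proof (intro ballI impI)
  fix B assume B: "B \<in> R" "B \<subseteq> P"
  obtain p where p: "P \<in> R" "P \<inter> cb X a = {p}" using assms by (auto simp: singular_def)
  show "below_ring R B \<simeq> below_ring R P \<or> below_ring R (P - B) \<simeq> below_ring R P"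
  proof (cases "p \<in> B")
    case True
    then have "B \<inter> cb X a = {p}" using p B by blast
    then have "singular a B" using B(1) by (auto simp: singular_def)
    then show ?thesis using singular_matched[OF _ assms] matched_imp_iso by blast
  next
    case False
    then have "(P - B) \<inter> cb X a = {p}" using p B by blast
    then have "singular a (P - B)" using p(1) B(1) Diff_mem by (auto simp: singular_def)
    then show ?thesis using singular_matched[OF _ assms] matched_imp_iso by blast
  qed
qed

lemma finite_sum_mono: "finite_sum Q A \<Longrightarrow> (\<And>P. Q P \<Longrightarrow> Q' P) \<Longrightarrow> finite_sum Q' A"
  by (induction rule: finite_sum.induct) (auto intro: finite_sum.intros)

lemma scattered_primitive:
  assumes "A \<in> R" "A \<inter> K = {}"
  shows "finite_sum (\<lambda>P. P \<in> R \<and> pseudo_indecomposable R P) A"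
  using scattered_finite_sum[OF assms]
  by (rule finite_sum_mono) (use singular_pseudo_indecomposable in \<open>auto simp: singular_def\<close>)

text \<open>What is trimmed off a lifted summand stays in the remainder of \<open>A\<close>, which
  still has trace \<open>Z\<close>; hence the induction over arbitrary \<open>A\<close>. Once the
  summands are used up the remainder is scattered.\<close>

lemma lift_primitive:
  assumes "finite_sum (\<lambda>P. P \<in> trace K \<and>
      measure_pseudo_indecomposable (kernel_ring X) (rank_measure X) P) Z"
    and "A \<in> R" "K \<inter> A = Z"
  shows "finite_sum (\<lambda>P. P \<in> R \<and> pseudo_indecomposable R P) A"
  using assms
proof (induction arbitrary: A rule: finite_sum.induct)
  case finite_sum_empty
  then show ?case by (intro scattered_primitive) blast+
next
  case (finite_sum_insert P Z)
  have "P \<subseteq> K \<inter> A" using finite_sum_insert.prems(2) by blast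
  then obtain P' where P': "P' \<in> R" "P' \<subseteq> A" "P = K \<inter> P'"
    using trace_below finite_sum_insert.hyps(1) finite_sum_insert.prems(1) by metis
  obtain S where S: "S \<in> R" "S \<subseteq> P' - K" "tight K (P' - S)"
    using trim[OF P'(1) closedin_kernel] by blast
  have eq: "K \<inter> (P' - S) = P" using P'(3) S(2) by blast
  have "pseudo_indecomposable R (P' - S)"
    using S(3) finite_sum_insert.hyps(1) P'(1) S(1)
    by (intro kernel_pseudo_indecomposable) (simp_all add: eq Diff_mem)
  moreover have "P' - S \<in> R" using P'(1) S(1) by (rule Diff_mem)
  ultimately have 1: "finite_sum (\<lambda>P. P \<in> R \<and> pseudo_indecomposable R P) (P' - S)"
    by (intro finite_sum_single) simp
  have "K \<inter> (A - (P' - S)) = Z"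
    using finite_sum_insert.prems(2) finite_sum_insert.hyps(3) eq by blast
  then have 2: "finite_sum (\<lambda>P. P \<in> R \<and> pseudo_indecomposable R P) (A - (P' - S))"
    using finite_sum_insert.prems(1) \<open>P' - S \<in> R\<close> by (intro finite_sum_insert.IH) (auto intro: Diff_mem)
  have "finite_sum (\<lambda>P. P \<in> R \<and> pseudo_indecomposable R P) ((P' - S) \<union> (A - (P' - S)))"
    using 1 2 by (rule finite_sum_Un) blast
  moreover have "(P' - S) \<union> (A - (P' - S)) = A" using P'(2) by blast
  ultimately show ?case by simp
qed

lemma primitive_ring_iff:
  "primitive_ring R \<longleftrightarrow> (\<forall>A\<in>R. finite_sum (\<lambda>P. P \<in> R \<and> pseudo_indecomposable R P) A)"
  unfolding primitive_ring_def finite_sum_iff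
  by (intro ball_cong refl arg_cong[where f = Ex] ext) blast

lemma measure_primitive_iff:
  "measure_primitive (kernel_ring X) \<sigma> \<longleftrightarrow>
    (\<forall>Z\<in>trace K. finite_sum (\<lambda>P. P \<in> trace K \<and> measure_pseudo_indecomposable (kernel_ring X) \<sigma> P) Z)"
  unfolding measure_primitive_def finite_sum_iff kernel_ring_trace
  by (intro ball_cong refl arg_cong[where f = Ex] ext) blast

section \<open>Ring isomorphisms come from point maps\<close>

text \<open>Stone duality: \<open>h\<close> carries the elements containing \<open>x\<close> to a
  family with the finite intersection property, and compactness of \<open>B\<close> gives a common
  point \<open>y\<close>. Complements in \<open>A\<close> give the converse implication.\<close>

lemma stone_point:
  assumes h: "h \<in> ring_iso (below_ring R A) (below_ring R B)" and A: "A \<in> R" "x \<in> A"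
  shows "\<exists>y\<in>B. \<forall>E\<in>R. E \<subseteq> A \<longrightarrow> (x \<in> E \<longleftrightarrow> y \<in> h E)"
proof -
  let ?\<U> = "h ` {E \<in> R. E \<subseteq> A \<and> x \<in> E}"
  have hA: "h A = B" using below_ring_iso_top[OF h A(1)] by simp
  have Inter_h: "\<exists>E\<in>R. E \<subseteq> A \<and> x \<in> E \<and> h E \<subseteq> \<Inter>F" if "finite F" "F \<subseteq> ?\<U>" for F
    using that
  proof (induction F rule: finite_induct)
    case empty
    then show ?case using A by auto
  next
    case (insert D F)
    then obtain E where E: "E \<in> R" "E \<subseteq> A" "x \<in> E" "h E \<subseteq> \<Inter>F" by auto
    obtain E' where E': "E' \<in> R" "E' \<subseteq> A" "x \<in> E'" "D = h E'" using insert.prems by auto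
    have "h (E \<inter> E') = h E \<inter> h E'" by (rule below_ring_iso_Int[OF h E(1,2) E'(1,2)])
    then have "h (E \<inter> E') \<subseteq> \<Inter>(insert D F)" using E(4) E'(4) by auto
    moreover have "E \<inter> E' \<in> R" using E(1) E'(1) by (rule Int_mem)
    moreover have "E \<inter> E' \<subseteq> A" "x \<in> E \<inter> E'" using E E' by auto
    ultimately show ?case by blast
  qed
  have "\<exists>y. y \<in> B \<inter> \<Inter>?\<U>"
  proof (rule ccontr)
    assume none: "\<nexists>y. y \<in> B \<inter> \<Inter>?\<U>"
    have B: "B \<in> R" using below_ring_iso_mem(1)[OF h A(1)] hA by simp
    have "\<exists>F. finite F \<and> F \<subseteq> (\<lambda>D. topspace X - D) ` ?\<U> \<and> B \<subseteq> \<Union>F"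
    proof (rule compactinD[OF compact_opensD(1)[OF B]])
      fix U assume "U \<in> (\<lambda>D. topspace X - D) ` ?\<U>"
      then obtain E where E: "E \<in> R" "E \<subseteq> A" "U = topspace X - h E" by auto
      then show "openin X U"
        using compact_open_closedin[OF below_ring_iso_mem(1)[OF h E(1,2)]] by blast
    next
      show "B \<subseteq> \<Union>((\<lambda>D. topspace X - D) ` ?\<U>)"
      proof
        fix y assume "y \<in> B"
        then have "y \<notin> \<Inter>?\<U>" using none by blast
        then obtain D where "D \<in> ?\<U>" "y \<notin> D" unfolding Inter_iff by blast
        moreover have "y \<in> topspace X" using \<open>y \<in> B\<close> compact_opensD(3)[OF B] by blast
        ultimately show "y \<in> \<Union>((\<lambda>D. topspace X - D) ` ?\<U>)" by blast
      qed
    qed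
    then obtain F where "finite F" "F \<subseteq> (\<lambda>D. topspace X - D) ` ?\<U>" and BF: "B \<subseteq> \<Union>F" by auto
    then obtain G where G: "finite G" "G \<subseteq> ?\<U>" "F = (\<lambda>D. topspace X - D) ` G"
      using finite_subset_image[of F "\<lambda>D. topspace X - D" ?\<U>] by auto
    obtain E where E: "E \<in> R" "E \<subseteq> A" "x \<in> E" "h E \<subseteq> \<Inter>G"
      using Inter_h[OF G(1,2)] by auto
    have "h E \<subseteq> B" by (rule below_ring_iso_mem(2)[OF h E(1,2)])
    \<comment> \<open>\<open>h E\<close> lies in every member of \<open>G\<close>, yet is covered by
      their complements.\<close>
    then have "h E \<subseteq> h {}" using BF E(4) unfolding G(3) by blast
    then have "E \<subseteq> {}" using below_ring_iso_subset_iff[OF h E(1,2) empty_mem] by blast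
    then show False using E(3) by blast
  qed
  then obtain y where "y \<in> B \<inter> \<Inter>?\<U>" by (rule exE)
  then have y: "y \<in> B" "\<And>E. E \<in> R \<Longrightarrow> E \<subseteq> A \<Longrightarrow> x \<in> E \<Longrightarrow> y \<in> h E" by auto
  have "x \<in> E" if E: "E \<in> R" "E \<subseteq> A" "y \<in> h E" for E
  proof (rule ccontr)
    assume "x \<notin> E"
    then have "y \<in> h (A - E)" using A E by (intro y(2)) (auto intro: Diff_mem)
    then show False using below_ring_iso_Diff[OF h A(1) order_refl E(1,2)] E(3) by blast
  qed
  with y show ?thesis by blast
qed

text \<open>A homeomorphism between compact open sets, phrased through \<open>R\<close> so that
  limits can be transported by the base criteria.\<close>

definition local_homeo :: "('a \<Rightarrow> 'a) \<Rightarrow> 'a set \<Rightarrow> 'a set \<Rightarrow> bool"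
  where "local_homeo f A B \<longleftrightarrow> A \<in> R \<and> B \<in> R \<and> bij_betw f A B \<and>
    (\<forall>E\<in>R. E \<subseteq> A \<longrightarrow> f ` E \<in> R) \<and> (\<forall>E\<in>R. E \<subseteq> B \<longrightarrow> A \<inter> f -` E \<in> R)"

text \<open>Compact open sets separate points, which makes the point map injective;
  \<open>stone_point\<close> for the inverse \<open>g\<close> makes it onto. On elements below
  \<open>A\<close> its image map is \<open>h\<close>.\<close>

lemma iso_imp_local_homeo:
  assumes h: "h \<in> ring_iso (below_ring R A) (below_ring R B)" and A: "A \<in> R"
  shows "\<exists>f. local_homeo f A B"
proof -
  have hA: "h A = B" using below_ring_iso_top[OF h A(1)] by simp
  have B: "B \<in> R" using below_ring_iso_mem(1)[OF h A] hA by simp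
  obtain g where g: "g \<in> ring_iso (below_ring R B) (below_ring R A)"
    "\<And>C. C \<in> R \<Longrightarrow> C \<subseteq> A \<Longrightarrow> g (h C) = C" "\<And>D. D \<in> R \<Longrightarrow> D \<subseteq> B \<Longrightarrow> h (g D) = D"
    using below_ring_iso_inv[OF h A] by metis
  have "\<exists>f. \<forall>x\<in>A. f x \<in> B \<and> (\<forall>E\<in>R. E \<subseteq> A \<longrightarrow> (x \<in> E \<longleftrightarrow> f x \<in> h E))"
    using stone_point[OF h A] by (intro bchoice) blast
  then obtain f where f: "\<And>x. x \<in> A \<Longrightarrow> f x \<in> B"
    "\<And>x E. x \<in> A \<Longrightarrow> E \<in> R \<Longrightarrow> E \<subseteq> A \<Longrightarrow> x \<in> E \<longleftrightarrow> f x \<in> h E"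
    by blast
  have sep: "x = y"
    if A: "A \<in> R" and xy: "x \<in> A" "y \<in> A" and xE: "\<And>E. E \<in> R \<Longrightarrow> E \<subseteq> A \<Longrightarrow> x \<in> E \<Longrightarrow> y \<in> E" for A x y
  proof (rule ccontr)
    assume "x \<noteq> y"
    then have "x \<in> A - {y}" using xy by simp
    have "y \<in> topspace X" using A xy(2) compact_opensD(3) by blast
    then have "closedin X {y}" by (intro compactin_imp_closedin[OF Hausdorff]) simp
    then have "openin X (A - {y})" using compact_opensD(2)[OF A] by blast
    then obtain N where "N \<in> R" "x \<in> N" "N \<subseteq> A - {y}"
      using \<open>x \<in> A - {y}\<close> by (rule compact_open_base)
    then show False using xE[of N] by blast
  qed
  have surj: "\<exists>x\<in>A. f x = y" if y: "y \<in> B" for y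
  proof -
    obtain x where x: "x \<in> A" "\<And>E. E \<in> R \<Longrightarrow> E \<subseteq> B \<Longrightarrow> y \<in> E \<longleftrightarrow> x \<in> g E"
      using stone_point[OF g(1) B y] by blast
    have "y = f x"
    proof (rule sep[OF B y f(1)[OF x(1)]])
      fix E assume E: "E \<in> R" "E \<subseteq> B" "y \<in> E"
      then have "x \<in> g E" using x(2) by blast
      then show "f x \<in> E"
        using f(2)[OF x(1), of "g E"] below_ring_iso_mem[OF g(1) E(1,2)] g(3)[OF E(1,2)] by simp
    qed
    then show ?thesis using x(1) by blast
  qed
  have "inj_on f A"
    using f(2) by (intro inj_onI sep[OF A]) metis+
  then have bij: "bij_betw f A B"
    using surj f(1) by (auto simp: bij_betw_def)
  have img: "f ` E = h E" if E: "E \<in> R" "E \<subseteq> A" for E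
  proof
    show "f ` E \<subseteq> h E" using f(2)[OF _ E] E(2) by blast
    show "h E \<subseteq> f ` E"
    proof
      fix y assume y: "y \<in> h E"
      then have "y \<in> B" using below_ring_iso_mem(2)[OF h E] by blast
      then obtain x where "x \<in> A" "f x = y" using surj by blast
      then show "y \<in> f ` E" using f(2)[OF _ E] y by blast
    qed
  qed
  have "A \<inter> f -` E \<in> R" if E: "E \<in> R" "E \<subseteq> B" for E
  proof -
    have gE: "g E \<in> R" "g E \<subseteq> A" using below_ring_iso_mem[OF g(1) E] .
    have "A \<inter> f -` E = g E" using f(2)[OF _ gE] gE(2) g(3)[OF E] by auto
    then show ?thesis using gE by simp
  qed
  then have "local_homeo f A B"
    unfolding local_homeo_def using A B bij img below_ring_iso_mem(1)[OF h] by simp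
  then show ?thesis by blast
qed

lemma local_homeo_inv:
  assumes "local_homeo f A B"
  shows "local_homeo (inv_into A f) B A"
proof -
  note f = assms[unfolded local_homeo_def]
  have bij: "bij_betw f A B" using f by blast
  have 1: "inv_into A f ` E = A \<inter> f -` E" if "E \<subseteq> B" for E
    using bij that unfolding bij_betw_def
    by (auto simp: inv_into_into f_inv_into_f image_iff) (metis inv_into_f_f)+
  have 2: "B \<inter> inv_into A f -` E = f ` E" if "E \<subseteq> A" for E
    using bij that unfolding bij_betw_def
    by (auto simp: inv_into_f_f image_iff)
  show ?thesis
    unfolding local_homeo_def using f 1 2 bij_betw_inv_into[OF bij] by simp
qed

text \<open>Limits at a point of \<open>A\<close> are decided inside the open set \<open>A\<close>,
  so a correspondence of \<open>S\<close> and \<open>T\<close> there is enough.\<close>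

lemma local_homeo_derived_set:
  assumes f: "local_homeo f A B" and ST: "\<And>x. x \<in> A \<Longrightarrow> x \<in> S \<longleftrightarrow> f x \<in> T"
    and x: "x \<in> A" "x \<in> X derived_set_of S"
  shows "f x \<in> X derived_set_of T"
proof -
  have B: "B \<in> R" "f x \<in> B" and A: "A \<in> R" and inj: "inj_on f A" and im: "f ` A = B"
    using f x(1) by (auto simp: local_homeo_def bij_betw_def)
  show ?thesis
    unfolding derived_set_base_iff[OF B]
  proof (intro ballI impI)
    fix E assume E: "E \<in> R" "f x \<in> E" "E \<subseteq> B"
    then have "A \<inter> f -` E \<in> R" using f by (simp add: local_homeo_def)
    then obtain y where "y \<in> A \<inter> f -` E" "y \<noteq> x" "y \<in> S"
      using x derived_set_base_iff[OF A x(1), of S] E(2) by (metis IntI Int_lower1 vimageI)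
    then have "f y \<in> E" "f y \<noteq> f x" "f y \<in> T" using ST inj x(1) by (auto simp: inj_on_def)
    then show "\<exists>y\<in>E. y \<noteq> f x \<and> y \<in> T" by blast
  qed
qed

lemma local_homeo_closure:
  assumes f: "local_homeo f A B" and ST: "\<And>x. x \<in> A \<Longrightarrow> x \<in> S \<longleftrightarrow> f x \<in> T"
    and x: "x \<in> A" "x \<in> X closure_of S"
  shows "f x \<in> X closure_of T"
proof -
  have B: "B \<in> R" "f x \<in> B" and A: "A \<in> R"
    using f x(1) by (auto simp: local_homeo_def bij_betw_def)
  show ?thesis
    unfolding closure_base_iff[OF B]
  proof (intro ballI impI)
    fix E assume E: "E \<in> R" "f x \<in> E" "E \<subseteq> B"
    then have "A \<inter> f -` E \<in> R" using f by (simp add: local_homeo_def)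
    then have "A \<inter> f -` E \<inter> S \<noteq> {}"
      using x closure_base_iff[OF A x(1), of S] E(2) by (metis IntI Int_lower1 vimageI)
    then show "E \<inter> T \<noteq> {}" using ST by blast
  qed
qed

text \<open>Turns the correspondence into one for the inverse map, so that each converse below is
  the same lemma applied to \<open>inv_into A f\<close>.\<close>

lemma local_homeo_flip:
  assumes f: "local_homeo f A B" and ST: "\<And>x. x \<in> A \<Longrightarrow> x \<in> S \<longleftrightarrow> f x \<in> T" and y: "y \<in> B"
  shows "y \<in> T \<longleftrightarrow> inv_into A f y \<in> S"
proof -
  have im: "f ` A = B" using f by (simp add: local_homeo_def bij_betw_def)
  then have "inv_into A f y \<in> A" "f (inv_into A f y) = y"
    using y by (auto intro: inv_into_into f_inv_into_f)
  then show ?thesis using ST by metis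
qed

lemma local_homeo_inv_apply:
  assumes "local_homeo f A B" "x \<in> A"
  shows "inv_into A f (f x) = x" "f x \<in> B"
  using assms by (auto simp: local_homeo_def bij_betw_def)

lemma local_homeo_cb:
  assumes f: "local_homeo f A B"
  shows "x \<in> A \<Longrightarrow> x \<in> cb X \<xi> \<longleftrightarrow> f x \<in> cb X \<xi>"
proof (induction \<xi> arbitrary: x rule: less_induct)
  case (less \<xi>)
  have IH: "y \<in> cb X \<eta> \<longleftrightarrow> f y \<in> cb X \<eta>" if "\<eta> < \<xi>" "y \<in> A" for \<eta> y
    using less.IH that by blast
  have "x \<in> X derived_set_of cb X \<eta> \<longleftrightarrow> f x \<in> X derived_set_of cb X \<eta>" if \<eta>: "\<eta> < \<xi>" for \<eta>
  proof
    show "f x \<in> X derived_set_of cb X \<eta>" if "x \<in> X derived_set_of cb X \<eta>"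
      using local_homeo_derived_set[OF f IH[OF \<eta>] less.prems that] .
    show "x \<in> X derived_set_of cb X \<eta>" if "f x \<in> X derived_set_of cb X \<eta>"
      using local_homeo_derived_set[OF local_homeo_inv[OF f] local_homeo_flip[OF f IH[OF \<eta>]] _ that]
        local_homeo_inv_apply[OF f less.prems] by simp
  qed
  moreover have "x \<in> topspace X" "f x \<in> topspace X"
    using less.prems f local_homeo_inv_apply(2)[OF f less.prems] compact_opensD(3)
    unfolding local_homeo_def by blast+
  ultimately show ?case by (simp add: cb_mem_iff[of _ X \<xi>])
qed

lemma local_homeo_kernel:
  assumes "local_homeo f A B" "x \<in> A"
  shows "x \<in> K \<longleftrightarrow> f x \<in> K"
  using local_homeo_cb[OF assms] by (simp add: perfect_kernel_def)

lemma local_homeo_rank: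
  assumes f: "local_homeo f A B" and x: "x \<in> A"
  shows "rank_fun X (f x) = rank_fun X x"
proof -
  have ST: "y \<in> cb X \<xi> - K \<longleftrightarrow> f y \<in> cb X \<xi> - K" if "y \<in> A" for y \<xi>
    using local_homeo_cb[OF f that] local_homeo_kernel[OF f that] by simp
  have "f x \<in> X closure_of (cb X \<xi> - K) \<longleftrightarrow> x \<in> X closure_of (cb X \<xi> - K)" for \<xi>
  proof
    show "f x \<in> X closure_of (cb X \<xi> - K)" if "x \<in> X closure_of (cb X \<xi> - K)"
      using local_homeo_closure[OF f ST x that] .
    show "x \<in> X closure_of (cb X \<xi> - K)" if "f x \<in> X closure_of (cb X \<xi> - K)"
      using local_homeo_closure[OF local_homeo_inv[OF f] local_homeo_flip[OF f ST] _ that]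
        local_homeo_inv_apply[OF f x] by simp
  qed
  then show ?thesis by (simp add: rank_fun_def)
qed

section \<open>From isomorphic compact open sets to measure-isomorphic traces on the kernel\<close>

lemma iso_imp_measure_iso:
  assumes "below_ring R A \<simeq> below_ring R B" and A: "A \<in> R"
  shows "measure_iso (kernel_ring X) (rank_measure X) (K \<inter> A) (K \<inter> B)"
proof -
  obtain f where f: "local_homeo f A B"
    using assms iso_imp_local_homeo unfolding is_ring_iso_def by blast
  have B: "B \<in> R" and inj: "inj_on f A" and im: "f ` A = B"
    using f by (auto simp: local_homeo_def bij_betw_def)
  have imK: "f ` (K \<inter> E) = K \<inter> f ` E" if "E \<subseteq> A" for E
    using local_homeo_kernel[OF f] that by blast
  have "image f \<in> ring_iso (below_ring (trace K) (K \<inter> A)) (below_ring (trace K) (K \<inter> B))"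
  proof (rule below_ring_isoI)
    show "f ` E \<in> trace K \<and> f ` E \<subseteq> K \<inter> B" if E: "E \<in> trace K" "E \<subseteq> K \<inter> A" for E
    proof -
      obtain E' where E': "E' \<in> R" "E' \<subseteq> A" "E = K \<inter> E'" using trace_below[OF E A] .
      then have "f ` E = K \<inter> f ` E'" "f ` E' \<in> R" using imK f by (auto simp: local_homeo_def)
      then show ?thesis using trace_mem E'(2) im by auto
    qed
    show "\<exists>E\<in>trace K. E \<subseteq> K \<inter> A \<and> f ` E = D" if D: "D \<in> trace K" "D \<subseteq> K \<inter> B" for D
    proof -
      obtain D' where D': "D' \<in> R" "D' \<subseteq> B" "D = K \<inter> D'" using trace_below[OF D B] .
      let ?E = "A \<inter> f -` D'"
      have "?E \<in> R" using D' f by (simp add: local_homeo_def)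
      moreover have "f ` ?E = D'" using D'(2) im by blast
      ultimately have "K \<inter> ?E \<in> trace K" "f ` (K \<inter> ?E) = D"
        using trace_mem imK[of ?E] D'(3) by auto
      then show ?thesis by (intro bexI[of _ "K \<inter> ?E"]) auto
    qed
    show "f ` (K \<inter> A) = K \<inter> B" using imK[of A] im by simp
    fix E E' assume "E \<in> trace K" "E \<subseteq> K \<inter> A" "E' \<in> trace K" "E' \<subseteq> K \<inter> A"
    then have E: "E \<subseteq> A" "E' \<subseteq> A" by blast+
    show "f ` E = f ` E' \<Longrightarrow> E = E'" using inj_on_image_eq_iff[OF inj E] by blast
    show "f ` (E \<inter> E') = f ` E \<inter> f ` E'" by (rule inj_on_image_Int[OF inj E])
    have "f ` (E - E') = f ` E - f ` E'" "f ` (E' - E) = f ` E' - f ` E"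
      using E by (auto intro!: inj_on_image_set_diff[OF inj])
    then show "f ` sym_diff E E' = sym_diff (f ` E) (f ` E')" by (simp add: image_Un)
  qed
  moreover have "rank_measure X (f ` E) = rank_measure X E" if "E \<subseteq> K \<inter> A" for E
  proof -
    have "rank_fun X (f x) = rank_fun X x" if "x \<in> E" for x
      using that \<open>E \<subseteq> K \<inter> A\<close> by (intro local_homeo_rank[OF f]) blast
    then have "(\<forall>x\<in>f ` E. Some (rank_fun X x) \<le> u) \<longleftrightarrow> (\<forall>x\<in>E. Some (rank_fun X x) \<le> u)" for u
      by simp
    then show ?thesis by (simp only: rank_measure_def image_is_empty)
  qed
  ultimately show ?thesis
    unfolding measure_iso_def kernel_ring_trace by (intro bexI[of _ "image f"]) auto
qed

lemma pseudo_indecomposable_trace: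
  assumes P: "P \<in> R" and PI: "pseudo_indecomposable R P"
  shows "measure_pseudo_indecomposable (kernel_ring X) (rank_measure X) (K \<inter> P)"
  unfolding measure_pseudo_indecomposable_def
proof (intro ballI impI)
  fix Z assume "Z \<in> kernel_ring X" "Z \<subseteq> K \<inter> P"
  then obtain B where B: "B \<in> R" "B \<subseteq> P" "Z = K \<inter> B"
    using trace_below P unfolding kernel_ring_trace by metis
  then have "below_ring R B \<simeq> below_ring R P \<or> below_ring R (P - B) \<simeq> below_ring R P"
    using PI unfolding pseudo_indecomposable_def by blast
  moreover have "K \<inter> P - Z = K \<inter> (P - B)" using B(3) by blast
  ultimately show "measure_iso (kernel_ring X) (rank_measure X) Z (K \<inter> P) \<or>
      measure_iso (kernel_ring X) (rank_measure X) (K \<inter> P - Z) (K \<inter> P)"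
    using iso_imp_measure_iso[of B P] iso_imp_measure_iso[of "P - B" P] B P Diff_mem by auto
qed

lemma primitive_trace:
  assumes "finite_sum (\<lambda>P. P \<in> R \<and> pseudo_indecomposable R P) A"
  shows "finite_sum (\<lambda>P. P \<in> trace K \<and>
    measure_pseudo_indecomposable (kernel_ring X) (rank_measure X) P) (K \<inter> A)"
  using assms
proof (induction rule: finite_sum.induct)
  case finite_sum_empty
  show ?case by (simp add: finite_sum.finite_sum_empty)
next
  case (finite_sum_insert P A)
  then show ?case
    unfolding Int_Un_distrib
    by (intro finite_sum.finite_sum_insert) (auto intro: trace_mem pseudo_indecomposable_trace)
qed

end

theorem theorem18:
  fixes W :: "'a topology"
  assumes "omega_Stone_space W"
  shows "primitive_space W \<longleftrightarrow> measure_primitive (kernel_ring W) (rank_measure W)"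
proof -
  interpret omega_stone W by standard (rule assms)
  show ?thesis
    unfolding primitive_space_def primitive_ring_iff measure_primitive_iff
  proof
    assume prim: "\<forall>A\<in>R. finite_sum (\<lambda>P. P \<in> R \<and> pseudo_indecomposable R P) A"
    show "\<forall>Z\<in>trace K. finite_sum (\<lambda>P. P \<in> trace K \<and>
        measure_pseudo_indecomposable (kernel_ring W) (rank_measure W) P) Z"
      using prim primitive_trace unfolding trace_def by auto
  next
    assume prim: "\<forall>Z\<in>trace K. finite_sum (\<lambda>P. P \<in> trace K \<and>
        measure_pseudo_indecomposable (kernel_ring W) (rank_measure W) P) Z"
    show "\<forall>A\<in>R. finite_sum (\<lambda>P. P \<in> R \<and> pseudo_indecomposable R P) A"
      using prim lift_primitive trace_mem by blast
  qed
qed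

end
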